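(* Let $G$ be a weakly connected oriented graph on $n\ge 2$ vertices $1,\dots,n$ with $m\ge 1$ edges $e_1,\dots,e_m$, with non-zero edge weights in $\mathbb{C}\setminus\mathbb{R}^-$ and complex signless Laplacian matrix $Q$. Then $$\det(Q)=\sum_{H\in\mathcal{U}(G)}\ \prod_{i=1}^{c(H)}2|W_{U_i\setminus C_i}|\cdot\alpha(C_i),\qquad \alpha(C_i)=\begin{cases}|wt(C_i)|-\operatorname{Re}(wt(C_i)) & \text{if } C_i \text{ is an even cycle},\\ |wt(C_i)|+\operatorname{Re}(wt(C_i)) & \text{if } C_i \text{ is an odd cycle},\end{cases}$$ where $\mathcal{U}(G)$ is the set of all spanning subgraphs $H$ of $G$ on $n$ vertices and $n$ edges whose connected components $U_1,\dots,U_{c(H)}$ are all unicyclic, with $C_i$ the cycle of $U_i$, such that $wt(C_i)\in\mathbb{C}\setminus\mathbb{R}^-$ whenever $C_i$ is odd and $wt(C_i)\in\mathbb{C}\setminus\mathbb{R}^+$ whenever $C_i$ is even. (An empty sum is $0$.)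
   Context: An oriented graph $G$ is obtained from a finite simple undirected graph $G_u$ (its underlying graph) by giving each edge exactly one direction; it is weakly connected if $G_u$ is connected. Each directed edge $(u,v)$ (from $u$ to $v$) has a non-zero complex weight $w_{uv}$. $\mathbb{R}^+$ and $\mathbb{R}^-$ denote the positive and the negative real numbers. The complex adjacency matrix is $A=(a_{ij})$ with $a_{ij}=w_{ij}$ if $(i,j)\in E(G)$, $a_{ij}=\overline{w_{ji}}$ if $(j,i)\in E(G)$, and $a_{ij}=0$ otherwise. The complex signless Laplacian matrix is $Q=D+A$, where $D$ is diagonal with $D_{ii}=\sum_{j\ne i}|a_{ij}|$. The weight of a walk $\gamma=(i_1,\dots,i_k)$ in $G_u$ is $wt(\gamma)=\prod_{s=1}^{k-1}a_{i_si_{s+1}}$. A cycle of $G$ means a cycle of $G_u$; $wt(C)$ is the weight of the closed walk going once around $C$ in either direction (the two directions give complex conjugate values, so conditions such as $wt(C)\in\mathbb{R}^\pm$ and the value $\operatorname{Re}(wt(C))$ do not depend on the choice). A unicyclic graph is a (weakly) connected graph with exactly one cycle; a spanning subgraph of $G$ has vertex set $V(G)$. $U_i\setminus C_i$ is obtained from $U_i$ by removing the edges of $C_i$, and $W_F$ is the product of all edge weights of an oriented graph $F$ (equal to $1$ if $F$ has no edges). *)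

theory Defs
  imports Complex_Main "Jordan_Normal_Form.Determinant" "Graph_Theory.Graph_Theory"
begin

definition oriented_graph :: "'a pair_pre_digraph \<Rightarrow> bool" where
  "oriented_graph G \<longleftrightarrow> pair_digraph G \<and> (\<forall>u v. (u, v) \<in> parcs G \<longrightarrow> (v, u) \<notin> parcs G)"

(* Graph_Theory's connected is connectivity of the symmetric closure (and excludes the
   null graph); the name is qualified because HOL-Analysis has a topological connected. *)
abbreviation weakly_connected :: "'a pair_pre_digraph \<Rightarrow> bool" where
  "weakly_connected G \<equiv> Digraph_Component.connected (with_proj G)"

definition pos_reals :: "complex set" where
  "pos_reals = complex_of_real ` {0<..}"

definition neg_reals :: "complex set" where
  "neg_reals = complex_of_real ` {..<0}"

definition adj_entry :: "'a pair_pre_digraph \<Rightarrow> ('a \<times> 'a \<Rightarrow> complex) \<Rightarrow> 'a \<Rightarrow> 'a \<Rightarrow> complex" where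
  "adj_entry G w i j =
     (if (i, j) \<in> parcs G then w (i, j)
      else if (j, i) \<in> parcs G then cnj (w (j, i))
      else 0)"

(* Matrices in Jordan_Normal_Form are indexed from 0, so graphs on n vertices have
   vertex set {0..<n}. *)
definition adjacency_mat :: "nat \<Rightarrow> nat pair_pre_digraph \<Rightarrow> (nat \<times> nat \<Rightarrow> complex) \<Rightarrow> complex mat" where
  "adjacency_mat n G w = mat n n (\<lambda>(i, j). adj_entry G w i j)"

definition degree_mat :: "nat \<Rightarrow> nat pair_pre_digraph \<Rightarrow> (nat \<times> nat \<Rightarrow> complex) \<Rightarrow> complex mat" where
  "degree_mat n G w = mat n n (\<lambda>(i, j).
     if i = j then complex_of_real (\<Sum>k\<in>{0..<n} - {i}. cmod (adj_entry G w i k)) else 0)"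

definition signless_laplacian :: "nat \<Rightarrow> nat pair_pre_digraph \<Rightarrow> (nat \<times> nat \<Rightarrow> complex) \<Rightarrow> complex mat" where
  "signless_laplacian n G w = degree_mat n G w + adjacency_mat n G w"

(* A walk in the underlying graph is the list of its steps (i, j), each of which may
   follow an arc or run against it. *)
definition walk_wt :: "'a pair_pre_digraph \<Rightarrow> ('a \<times> 'a \<Rightarrow> complex) \<Rightarrow> ('a \<times> 'a) list \<Rightarrow> complex" where
  "walk_wt G w p = (\<Prod>(i, j)\<leftarrow>p. adj_entry G w i j)"

(* p is a closed walk going exactly once round C. Graph_Theory's cycle admits the closed
   walk (u, v), (v, u) in a symmetric digraph; the length bound excludes it. *)
definition goes_round :: "('a \<times> 'a) list \<Rightarrow> 'a pair_pre_digraph \<Rightarrow> bool" where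
  "goes_round p C \<longleftrightarrow>
     pre_digraph.cycle (with_proj (mk_symmetric (with_proj C))) p \<and> 3 \<le> length p \<and>
     pverts C = fst ` set p \<and> parcs (mk_symmetric (with_proj C)) = set p \<union> (set p)\<inverse>"

definition graph_cycles :: "'a pair_pre_digraph \<Rightarrow> 'a pair_pre_digraph set" where
  "graph_cycles G = {C. subgraph (with_proj C) (with_proj G) \<and> (\<exists>p. goes_round p C)}"

(* Going round C in the other direction conjugates the weight; from another starting
   vertex it leaves it unchanged. The choice of p thus affects neither the membership in
   pos_reals or neg_reals nor the modulus and the real part. *)
definition cycle_wt :: "'a pair_pre_digraph \<Rightarrow> ('a \<times> 'a \<Rightarrow> complex) \<Rightarrow> 'a pair_pre_digraph \<Rightarrow> complex" where
  "cycle_wt G w C = walk_wt G w (SOME p. goes_round p C)"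

definition even_cycle :: "'a pair_pre_digraph \<Rightarrow> bool" where
  "even_cycle C \<longleftrightarrow> even (card (parcs C))"

definition unicyclic :: "'a pair_pre_digraph \<Rightarrow> bool" where
  "unicyclic U \<longleftrightarrow> weakly_connected U \<and> (\<exists>!C. C \<in> graph_cycles U)"

definition the_cycle :: "'a pair_pre_digraph \<Rightarrow> 'a pair_pre_digraph" where
  "the_cycle U = (THE C. C \<in> graph_cycles U)"

definition weak_components :: "'a pair_pre_digraph \<Rightarrow> 'a pair_pre_digraph set" where
  "weak_components H = {U. pre_digraph.max_subgraph (with_proj H) Digraph_Component.connected (with_proj U)}"

definition remove_edges :: "'a pair_pre_digraph \<Rightarrow> 'a pair_pre_digraph \<Rightarrow> 'a pair_pre_digraph" where
  "remove_edges U C = \<lparr>pverts = pverts U, parcs = parcs U - parcs C\<rparr>"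

definition edge_wt_prod :: "('a \<times> 'a \<Rightarrow> complex) \<Rightarrow> 'a pair_pre_digraph \<Rightarrow> complex" where
  "edge_wt_prod w F = (\<Prod>e\<in>parcs F. w e)"

definition cycle_alpha :: "'a pair_pre_digraph \<Rightarrow> ('a \<times> 'a \<Rightarrow> complex) \<Rightarrow> 'a pair_pre_digraph \<Rightarrow> real" where
  "cycle_alpha G w C =
     (if even_cycle C then cmod (cycle_wt G w C) - Re (cycle_wt G w C)
      else cmod (cycle_wt G w C) + Re (cycle_wt G w C))"

definition unicyclic_subgraphs ::
    "'a pair_pre_digraph \<Rightarrow> ('a \<times> 'a \<Rightarrow> complex) \<Rightarrow> 'a pair_pre_digraph set" where
  "unicyclic_subgraphs G w =
     {H. spanning (with_proj H) (with_proj G) \<and> card (parcs H) = card (pverts G) \<and>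
         (\<forall>U\<in>weak_components H. unicyclic U \<and>
            (\<not> even_cycle (the_cycle U) \<longrightarrow> cycle_wt G w (the_cycle U) \<notin> neg_reals) \<and>
            (even_cycle (the_cycle U) \<longrightarrow> cycle_wt G w (the_cycle U) \<notin> pos_reals))}"

end

theory Submission
  imports Defs "HOL-Combinatorics.Cycles"
begin

text \<open>
  Give each arc \<open>e = (u, v)\<close> a column with entry \<open>w e / sqrt \<bar>w e\<bar>\<close> at \<open>u\<close> and
  \<open>sqrt \<bar>w e\<bar>\<close> at \<open>v\<close>. The resulting matrix \<open>B\<close> satisfies \<open>Q = B B*\<close>, so by the Cauchy-Binet
  formula \<open>det Q\<close> is the sum over the spanning subgraphs with \<open>n\<close> arcs of their own
  Gram determinants, and each of these is a product over weak components. For a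
  connected graph one removes leaves: a leaf \<open>v\<close> hanging on \<open>e\<close> contributes the factor \<open>\<bar>w e\<bar>\<close>
  and lies on no cycle. With fewer arcs than vertices this ends in an isolated vertex,
  which gives \<open>0\<close>; with equally many it ends in a two-regular connected graph, that is a
  cycle of length \<open>k\<close>, whose \<open>B\<close> has two nonzero diagonals with products \<open>P\<close>, \<open>P'\<close> such
  that \<open>P * cnj P' = wt\<close>. Hence the determinant is
  \<open>\<bar>P + (-1)^(k - 1) * P'\<bar>^2 = 2 \<bar>wt\<bar> + 2 (-1)^(k - 1) Re wt\<close>. Subgraphs violating the sign
  condition on a cycle have a vanishing factor.
\<close>

section \<open>Determinants over finite index sets\<close>

text \<open>The splitting of \<open>w e\<close> meets two demands at once: tail entry times
  conjugated head entry is \<open>w e\<close>, which produces \<open>A\<close>, and both entries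
  have modulus \<open>sqrt |w e|\<close>, which produces \<open>D\<close>. Matrices are functions on
  an arbitrary finite vertex set because leaf removal and the passage to components merely shrink
  that set, and nothing has to be renumbered. For a similar reason each Cauchy-Binet term stays a
  Gram determinant instead of a product of two minors: a minor would require an order on the arcs. A
  square incidence matrix is needed only for a cycle, where going round pairs each vertex with the
  edge to its successor. The obstacle is a component with more arcs than vertices, whose Gram
  determinant has no simple form. It never has to be evaluated: arcs and vertices agree in total, so
  some other component then has too few arcs and makes the product zero. Hence the induction on
  connected graphs treats only the deficient and the balanced case.\<close>

definition det_on :: "'a set \<Rightarrow> ('a \<Rightarrow> 'a \<Rightarrow> 'b :: field_char_0) \<Rightarrow> 'b" where
  "det_on V M = (\<Sum>p | p permutes V. of_int (sign p) * (\<Prod>i\<in>V. M i (p i)))"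

lemma det_on_cong:
  assumes "\<And>i j. i \<in> V \<Longrightarrow> j \<in> V \<Longrightarrow> M i j = N i j"
  shows "det_on V M = det_on V N"
  unfolding det_on_def
  by (intro sum.cong refl arg_cong2[where f = "(*)"] prod.cong) (auto simp: assms permutes_in_image)

text \<open>Composing with the transposition of \<open>u\<close> and \<open>v\<close> keeps each
  product and flips its sign, so the determinant equals its own negative; characteristic 0 turns
  this into 0.\<close>

lemma det_on_equal_rows:
  assumes "finite V" "u \<in> V" "v \<in> V" "u \<noteq> v" and eq: "\<And>j. j \<in> V \<Longrightarrow> M u j = M v j"
  shows "det_on V M = 0"
proof -
  define t where "t = Transposition.transpose u v"
  have t: "t permutes V" using assms unfolding t_def by (simp add: permutes_swap_id)
  have tt: "t \<circ> t = id" by (simp add: t_def)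
  have st: "sign t = -1" using assms by (simp add: t_def sign_swap_id)
  have swapped: "of_int (sign (p \<circ> t)) * (\<Prod>i\<in>V. M i ((p \<circ> t) i)) = - (of_int (sign p) * (\<Prod>i\<in>V. M i (p i)))"
    if p: "p permutes V" for p
  proof -
    have "sign (p \<circ> t) = - sign p"
      using sign_compose[of p t] p t st \<open>finite V\<close> by (simp add: permutation_permutes) blast
    moreover have "(\<Prod>i\<in>V. M i ((p \<circ> t) i)) = (\<Prod>i\<in>V. M (t i) (p (t i)))"
      using eq permutes_in_image[OF p] assms
      by (intro prod.cong refl) (auto simp: t_def Transposition.transpose_def)
    moreover have "\<dots> = (\<Prod>i\<in>V. M i (p i))"
      using prod.permute[OF t, of "\<lambda>i. M i (p i)"] by (simp add: o_def)
    ultimately show ?thesis by simp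
  qed
  have "det_on V M = (\<Sum>p | p permutes V. of_int (sign (p \<circ> t)) * (\<Prod>i\<in>V. M i ((p \<circ> t) i)))"
    unfolding det_on_def
    by (rule sum.reindex_bij_witness[of _ "\<lambda>p. p \<circ> t" "\<lambda>p. p \<circ> t"])
      (auto simp: o_assoc[symmetric] tt t intro: permutes_compose)
  also have "\<dots> = - det_on V M"
    unfolding det_on_def sum_negf[symmetric] by (intro sum.cong refl swapped) simp
  finally have "2 * det_on V M = 0" by simp
  then show ?thesis by simp
qed

lemma det_on_add_row_multiple:
  assumes "finite V" "u \<in> V" "v \<in> V" "u \<noteq> v"
    and N: "\<And>i j. i \<in> V \<Longrightarrow> j \<in> V \<Longrightarrow> N i j = (if i = u then M u j + c * M v j else M i j)"
  shows "det_on V N = det_on V M"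
proof -
  \<comment> \<open>\<open>L\<close> repeats row \<open>v\<close> in place of row \<open>u\<close>,
    so the part of the linear expansion that carries \<open>c\<close> vanishes.\<close>
  define L where "L i = (if i = u then M v else M i)" for i
  have "of_int (sign p) * (\<Prod>i\<in>V. N i (p i)) =
      of_int (sign p) * (\<Prod>i\<in>V. M i (p i)) + c * (of_int (sign p) * (\<Prod>i\<in>V. L i (p i)))"
    if "p permutes V" for p
  proof -
    have im: "i \<in> V \<Longrightarrow> p i \<in> V" for i using permutes_in_image[OF that] by simp
    have "(\<Prod>i\<in>V. N i (p i)) = (M u (p u) + c * M v (p u)) * (\<Prod>i\<in>V - {u}. M i (p i))"
      using assms(1,2) im by (subst prod.remove[of V u]) (auto simp: N)
    moreover have "(\<Prod>i\<in>V. M i (p i)) = M u (p u) * (\<Prod>i\<in>V - {u}. M i (p i))"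
      using assms(1,2) by (subst prod.remove[of V u]) auto
    moreover have "(\<Prod>i\<in>V. L i (p i)) = M v (p u) * (\<Prod>i\<in>V - {u}. M i (p i))"
      using assms(1,2) by (subst prod.remove[of V u]) (auto simp: L_def)
    ultimately show ?thesis by (simp add: algebra_simps)
  qed
  then have "det_on V N = det_on V M + c * det_on V L"
    by (simp add: det_on_def sum.distrib sum_distrib_left)
  moreover have "det_on V L = 0"
    using assms by (intro det_on_equal_rows[of V u v]) (auto simp: L_def)
  ultimately show ?thesis by simp
qed

text \<open>A permutation that sends a point of \<open>B\<close> into \<open>A\<close> meets a zero
  entry. By finiteness the remaining ones map \<open>B\<close> onto \<open>B\<close> and hence
  \<open>A\<close> onto \<open>A\<close>, so each is a product of a permutation of \<open>A\<close>
  and one of \<open>B\<close>, with multiplicative sign.\<close>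

lemma det_on_block_triangular:
  assumes fin: "finite A" "finite B" and disj: "A \<inter> B = {}"
    and zero: "\<And>i j. i \<in> B \<Longrightarrow> j \<in> A \<Longrightarrow> M i j = 0"
  shows "det_on (A \<union> B) M = det_on A M * det_on B M"
proof -
  define f where "f p = of_int (sign p) * (\<Prod>i\<in>A \<union> B. M i (p i))" for p
  \<comment> \<open>Extending by the identity outside \<open>C\<close> makes the restriction a
    permutation in the sense of \<open>permutes\<close>, with a sign of its own.\<close>
  define on where "on C p x = (if x \<in> C then p x else x)" for C and p :: "'a \<Rightarrow> 'a" and x
  let ?S = "{p. p permutes A \<union> B \<and> p ` B \<subseteq> B}"
  have split: "p ` A = A \<and> p ` B = B" if "p \<in> ?S" for p
  proof -
    have p: "p permutes A \<union> B" and B: "p ` B \<subseteq> B" using that by auto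
    have inj: "inj p" using p by (rule permutes_inj)
    have eqB: "p ` B = B"
      using B fin(2) inj by (meson endo_inj_surj inj_on_subset subset_UNIV)
    have "p ` A \<union> p ` B = A \<union> B" using permutes_image[OF p] by (simp add: image_Un)
    moreover have "p ` A \<inter> p ` B = {}" using disj inj by (simp add: image_Int[symmetric])
    moreover have "X = A" if "X \<union> B = A \<union> B" "X \<inter> B = {}" for X using that disj by blast
    ultimately show ?thesis using eqB by metis
  qed
  have on_perm: "on C p permutes C" if "p ` C = C" "inj p" for C p
  proof (rule bij_imp_permutes)
    have "on C p ` C = p ` C" by (intro image_cong) (auto simp: on_def)
    moreover have "inj_on (on C p) C" using that by (auto simp: on_def inj_on_def)
    ultimately show "bij_betw (on C p) C C" using that by (simp add: bij_betw_def)
  qed (auto simp: on_def)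
  have "det_on (A \<union> B) M = sum f ?S"
    unfolding det_on_def f_def[symmetric]
  proof (rule sum.mono_neutral_right)
    show "\<forall>p\<in>{p. p permutes A \<union> B} - ?S. f p = 0"
    proof
      fix p assume "p \<in> {p. p permutes A \<union> B} - ?S"
      then obtain i where "p permutes A \<union> B" "i \<in> B" "p i \<notin> B" by auto
      then have "p i \<in> A" using permutes_in_image[of p "A \<union> B" i] by auto
      then have "M i (p i) = 0" using zero \<open>i \<in> B\<close> by auto
      then show "f p = 0" using fin \<open>i \<in> B\<close> unfolding f_def by (auto intro!: prod_zero)
    qed
  qed (use fin in \<open>auto simp: finite_permutations\<close>)
  also have "\<dots> = (\<Sum>(q, r)\<in>{q. q permutes A} \<times> {r. r permutes B}.
      (of_int (sign q) * (\<Prod>i\<in>A. M i (q i))) * (of_int (sign r) * (\<Prod>i\<in>B. M i (r i))))"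
  proof (rule sum.reindex_bij_witness[of _ "\<lambda>(q, r). q \<circ> r" "\<lambda>p. (on A p, on B p)"])
    fix p assume p: "p \<in> ?S"
    then have inj: "inj p" by (auto intro: permutes_inj)
    have im: "p ` A = A" "p ` B = B" using split[OF p] by auto
    have q: "on A p permutes A" and r: "on B p permutes B" using on_perm im inj by auto
    have comp: "on A p \<circ> on B p = p"
    proof
      fix x
      have "p x = x" if "x \<notin> A" "x \<notin> B" using p that permutes_not_in[of p "A \<union> B" x] by auto
      moreover have "p x \<notin> A" if "x \<in> B" using that im disj by auto
      ultimately show "(on A p \<circ> on B p) x = p x" using disj by (auto simp: on_def)
    qed
    then show "(case (on A p, on B p) of (q, r) \<Rightarrow> q \<circ> r) = p" by simp
    show "(on A p, on B p) \<in> {q. q permutes A} \<times> {r. r permutes B}" using q r by simp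
    have "sign p = sign (on A p) * sign (on B p)"
      using q r fin by (subst comp[symmetric]) (auto intro!: sign_compose simp: permutation_permutes)
    moreover have "(\<Prod>i\<in>A \<union> B. M i (p i)) = (\<Prod>i\<in>A. M i (on A p i)) * (\<Prod>i\<in>B. M i (on B p i))"
      using fin disj by (subst prod.union_disjoint) (auto simp: on_def)
    ultimately show "(case (on A p, on B p) of (q, r) \<Rightarrow>
      (of_int (sign q) * (\<Prod>i\<in>A. M i (q i))) * (of_int (sign r) * (\<Prod>i\<in>B. M i (r i)))) = f p"
      by (simp add: f_def)
  next
    fix z assume "z \<in> {q. q permutes A} \<times> {r. r permutes B}"
    then obtain q r where z: "z = (q, r)" and q: "q permutes A" and r: "r permutes B" by auto
    have qB: "q x = x" if "x \<in> B" for x using q that disj permutes_not_in[of q A x] by auto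
    have rA: "r x = x" if "x \<in> A" for x using r that disj permutes_not_in[of r B x] by auto
    have rB: "r x \<in> B" if "x \<in> B" for x using r that by (simp add: permutes_in_image)
    have "q permutes A \<union> B" "r permutes A \<union> B" using q r by (auto intro: permutes_subset)
    then have "q \<circ> r permutes A \<union> B" by (intro permutes_compose)
    then show "(case z of (q, r) \<Rightarrow> q \<circ> r) \<in> ?S" using z qB rB by auto
    have "on A (q \<circ> r) x = q x" for x using rA permutes_not_in[OF q] by (auto simp: on_def)
    moreover have "on B (q \<circ> r) x = r x" for x
      using rB qB permutes_not_in[OF r] by (auto simp: on_def)
    ultimately show "(on A (case z of (q, r) \<Rightarrow> q \<circ> r), on B (case z of (q, r) \<Rightarrow> q \<circ> r)) = z"
      using z by auto
  qed
  also have "\<dots> = det_on A M * det_on B M"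
    by (simp add: det_on_def sum_product sum.cartesian_product)
  finally show ?thesis .
qed

lemma det_on_empty [simp]: "det_on {} M = 1"
  by (simp add: det_on_def)

lemma det_on_singleton [simp]: "det_on {v} M = M v v"
proof -
  have "{p. p permutes {v}} = {id}" by (auto simp: permutes_sing)
  then show ?thesis by (simp add: det_on_def)
qed

lemma det_on_Union_blocks:
  assumes "finite P" "\<And>A. A \<in> P \<Longrightarrow> finite A" "pairwise disjnt P"
    and "\<And>A B i j. A \<in> P \<Longrightarrow> B \<in> P \<Longrightarrow> A \<noteq> B \<Longrightarrow> i \<in> A \<Longrightarrow> j \<in> B \<Longrightarrow> M i j = 0"
  shows "det_on (\<Union>P) M = (\<Prod>A\<in>P. det_on A M)"
  using assms
proof (induction P rule: finite_induct)
  case (insert A P)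
  have "A \<inter> \<Union>P = {}"
    using insert.prems(2) insert.hyps(2) by (fastforce simp: pairwise_insert disjnt_def)
  moreover have "M i j = 0" if "i \<in> \<Union>P" "j \<in> A" for i j
    using that insert.prems(3)[of _ A i j] insert.hyps(2) by blast
  ultimately have "det_on (A \<union> \<Union>P) M = det_on A M * det_on (\<Union>P) M"
    using insert.prems(1) insert.hyps(1) by (intro det_on_block_triangular) auto
  moreover have "det_on (\<Union>P) M = (\<Prod>A\<in>P. det_on A M)"
    using insert.prems(1,2) insert.prems(3)[OF insertI2 insertI2]
    by (intro insert.IH) (auto simp: pairwise_insert)
  ultimately show ?case using insert.hyps by simp
qed simp

text \<open>Multilinearity in the rows; functions that are not injective produce two equal rows.\<close>

lemma det_on_sum_rows:
  assumes "finite V" "finite S"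
  shows "det_on V (\<lambda>i j. \<Sum>e\<in>S. b i e * c j e) =
    (\<Sum>f | f \<in> V \<rightarrow>\<^sub>E S \<and> inj_on f V. (\<Prod>i\<in>V. b i (f i)) * det_on V (\<lambda>i j. c j (f i)))"
proof -
  have "det_on V (\<lambda>i j. \<Sum>e\<in>S. b i e * c j e) = (\<Sum>p | p permutes V. \<Sum>f\<in>V \<rightarrow>\<^sub>E S.
      of_int (sign p) * (\<Prod>i\<in>V. b i (f i) * c (p i) (f i)))"
    using assms by (simp add: det_on_def prod_sum_PiE sum_distrib_left)
  also have "\<dots> = (\<Sum>f\<in>V \<rightarrow>\<^sub>E S. (\<Prod>i\<in>V. b i (f i)) * det_on V (\<lambda>i j. c j (f i)))"
    by (subst sum.swap) (simp add: det_on_def prod.distrib sum_distrib_left mult_ac)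
  also have "\<dots> = (\<Sum>f | f \<in> V \<rightarrow>\<^sub>E S \<and> inj_on f V. (\<Prod>i\<in>V. b i (f i)) * det_on V (\<lambda>i j. c j (f i)))"
  proof (rule sum.mono_neutral_right)
    show "\<forall>f\<in>(V \<rightarrow>\<^sub>E S) - {f. f \<in> V \<rightarrow>\<^sub>E S \<and> inj_on f V}.
        (\<Prod>i\<in>V. b i (f i)) * det_on V (\<lambda>i j. c j (f i)) = 0"
    proof
      fix f assume "f \<in> (V \<rightarrow>\<^sub>E S) - {f. f \<in> V \<rightarrow>\<^sub>E S \<and> inj_on f V}"
      then obtain u v where "u \<in> V" "v \<in> V" "u \<noteq> v" "f u = f v" by (auto simp: inj_on_def)
      then show "(\<Prod>i\<in>V. b i (f i)) * det_on V (\<lambda>i j. c j (f i)) = 0"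
        using det_on_equal_rows[of V u v "\<lambda>i j. c j (f i)"] assms by simp
    qed
  qed (use assms in \<open>auto intro: finite_PiE\<close>)
  finally show ?thesis .
qed

text \<open>The injections in the row expansion are grouped by their image \<open>T\<close>. Those
  with image \<open>T\<close> are all injections into \<open>T\<close>, because the cardinalities
  agree, and summing over them is the row expansion of the Gram determinant of \<open>T\<close> read
  backwards.\<close>

lemma Cauchy_Binet_det_on:
  assumes "finite V" "finite S"
  shows "det_on V (\<lambda>i j. \<Sum>e\<in>S. b i e * c j e) =
    (\<Sum>T | T \<subseteq> S \<and> card T = card V. det_on V (\<lambda>i j. \<Sum>e\<in>T. b i e * c j e))"
proof -
  define g where "g f = (\<Prod>i\<in>V. b i (f i)) * det_on V (\<lambda>i j. c j (f i))" for f
  let ?F = "{f. f \<in> V \<rightarrow>\<^sub>E S \<and> inj_on f V}"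
  have "finite (V \<rightarrow>\<^sub>E S)" using assms by (intro finite_PiE)
  then have "finite ?F" by (rule rev_finite_subset) auto
  then have "sum g ?F = (\<Sum>T | T \<subseteq> S \<and> card T = card V. sum g {f \<in> ?F. f ` V = T})"
    using assms by (intro sum.group[symmetric]) (auto simp: card_image)
  also have "\<dots> = (\<Sum>T | T \<subseteq> S \<and> card T = card V. sum g {f. f \<in> V \<rightarrow>\<^sub>E T \<and> inj_on f V})"
  proof (intro sum.cong refl)
    fix T assume T: "T \<in> {T. T \<subseteq> S \<and> card T = card V}"
    have "f ` V = T" if "f \<in> V \<rightarrow>\<^sub>E T" "inj_on f V" for f
      using that T assms by (intro card_subset_eq) (auto simp: card_image intro: finite_subset)
    then show "{f \<in> ?F. f ` V = T} = {f. f \<in> V \<rightarrow>\<^sub>E T \<and> inj_on f V}"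
      using T by (auto simp: PiE_iff)
  qed
  also have "\<dots> = (\<Sum>T | T \<subseteq> S \<and> card T = card V. det_on V (\<lambda>i j. \<Sum>e\<in>T. b i e * c j e))"
    using assms by (intro sum.cong refl) (auto simp: det_on_sum_rows g_def finite_subset)
  finally show ?thesis using assms by (simp add: det_on_sum_rows g_def)
qed

lemma det_on_permute_rows:
  assumes "finite V" "p permutes V"
  shows "det_on V (\<lambda>i. N (p i)) = of_int (sign p) * det_on V N"
proof -
  have "det_on V (\<lambda>i. N (p i)) =
      (\<Sum>q | q permutes V. of_int (sign (q \<circ> p)) * (\<Prod>i\<in>V. N (p i) ((q \<circ> p) i)))"
    unfolding det_on_def using assms(2)
    by (intro sum.reindex_bij_witness[of _ "\<lambda>q. q \<circ> p" "\<lambda>q. q \<circ> inv_into UNIV p"])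
      (auto simp: o_assoc[symmetric] permutes_inv_o intro: permutes_compose permutes_inv)
  also have "\<dots> = (\<Sum>q | q permutes V. of_int (sign p) * (of_int (sign q) * (\<Prod>i\<in>V. N i (q i))))"
  proof (intro sum.cong refl)
    fix q assume "q \<in> {q. q permutes V}"
    then have "sign (q \<circ> p) = sign q * sign p"
      using assms by (intro sign_compose) (auto simp: permutation_permutes)
    moreover have "(\<Prod>i\<in>V. N (p i) ((q \<circ> p) i)) = (\<Prod>i\<in>V. N i (q i))"
      using prod.permute[OF assms(2), of "\<lambda>i. N i (q i)"] by (simp add: o_def)
    ultimately show "of_int (sign (q \<circ> p)) * (\<Prod>i\<in>V. N (p i) ((q \<circ> p) i)) =
        of_int (sign p) * (of_int (sign q) * (\<Prod>i\<in>V. N i (q i)))" by simp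
  qed
  finally show ?thesis by (simp add: det_on_def sum_distrib_left)
qed

lemma det_on_transpose:
  assumes "finite V"
  shows "det_on V (\<lambda>i j. M j i) = det_on V M"
  unfolding det_on_def
proof (rule sum.reindex_bij_witness[of _ "inv_into UNIV" "inv_into UNIV"])
  fix p assume p: "p \<in> {p. p permutes V}"
  then have pm: "p permutes V" by simp
  show "inv_into UNIV (inv_into UNIV p) = p" "inv_into UNIV p \<in> {p. p permutes V}"
    using pm by (auto simp: permutes_inv_inv permutes_inv)
  have "sign (inv_into UNIV p) = sign p" using pm assms by (intro sign_inverse) (auto simp: permutation_permutes)
  moreover have "(\<Prod>i\<in>V. M i (inv_into UNIV p i)) = (\<Prod>i\<in>V. M (p i) i)"
    using prod.permute[OF pm, of "\<lambda>i. M i (inv_into UNIV p i)"] pm by (simp add: o_def permutes_inverses)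
  ultimately show "of_int (sign (inv_into UNIV p)) * (\<Prod>i\<in>V. M i (inv_into UNIV p i)) =
      of_int (sign p) * (\<Prod>i\<in>V. M (p i) i)" by simp
qed (auto simp: permutes_inv_inv permutes_inv)

text \<open>This is the row expansion with \<open>S = V\<close>: the injections are permutations
  \<open>p\<close>, and permuting the second factor by \<open>p\<close> releases
  \<open>sign p\<close>, which completes the Leibniz sum of \<open>b\<close>.\<close>

lemma det_on_mult:
  assumes "finite V"
  shows "det_on V (\<lambda>i j. \<Sum>x\<in>V. b i x * c j x) = det_on V b * det_on V c"
proof -
  have "det_on V (\<lambda>i j. \<Sum>x\<in>V. b i x * c j x) =
      (\<Sum>p | p permutes V. (\<Prod>i\<in>V. b i (p i)) * det_on V (\<lambda>i j. c j (p i)))"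
    unfolding det_on_sum_rows[OF assms assms]
  \<comment> \<open>Off \<open>V\<close> an element of the function space is
    \<open>undefined\<close>, while a permutation of \<open>V\<close> is the identity there; the two
    witnesses translate between these conventions.\<close>
  proof (rule sum.reindex_bij_witness[of _ "\<lambda>p. restrict p V" "\<lambda>f x. if x \<in> V then f x else x"])
    fix f assume f: "f \<in> {f. f \<in> V \<rightarrow>\<^sub>E V \<and> inj_on f V}"
    then have "f ` V = V" using assms by (intro endo_inj_surj) auto
    with f have "bij_betw f V V" by (auto simp: bij_betw_def)
    then have "bij_betw (\<lambda>x. if x \<in> V then f x else x) V V"
      by (rule bij_betw_cong[THEN iffD1, rotated]) simp
    then show "(\<lambda>x. if x \<in> V then f x else x) \<in> {p. p permutes V}"
      by (auto intro!: bij_imp_permutes)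
    show "restrict (\<lambda>x. if x \<in> V then f x else x) V = f"
      using f by (auto simp: restrict_def PiE_iff extensional_def)
    show "(\<Prod>i\<in>V. b i (if i \<in> V then f i else i)) *
        det_on V (\<lambda>i j. c j (if i \<in> V then f i else i)) =
        (\<Prod>i\<in>V. b i (f i)) * det_on V (\<lambda>i j. c j (f i))"
      by (intro arg_cong2[where f = "(*)"] det_on_cong) auto
  next
    fix p assume "p \<in> {p. p permutes V}"
    then have p: "p permutes V" by simp
    show "restrict p V \<in> {f. f \<in> V \<rightarrow>\<^sub>E V \<and> inj_on f V}"
      using p by (auto simp: permutes_in_image permutes_inj_on)
    show "(\<lambda>x. if x \<in> V then restrict p V x else x) = p"
      using permutes_not_in[OF p] by auto
  qed
  also have "\<dots> = (\<Sum>p | p permutes V. of_int (sign p) * (\<Prod>i\<in>V. b i (p i)) * det_on V c)"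
    using det_on_permute_rows[OF assms, of _ "\<lambda>i j. c j i"] det_on_transpose[OF assms, of c]
    by (intro sum.cong refl) simp
  finally show ?thesis by (simp add: det_on_def sum_distrib_right)
qed

section \<open>Cyclic permutations and matrices with two cyclic diagonals\<close>

lemma sign_cycle_of_list:
  "distinct xs \<Longrightarrow> sign (cycle_of_list xs) = (-1) ^ (length xs - 1)"
proof (induction xs rule: cycle_of_list.induct)
  case (1 i j cs)
  have "sign (Transposition.transpose i j \<circ> cycle_of_list (j # cs)) = - ((-1) ^ length cs)"
    using sign_compose[OF permutation_swap_id[of i j] permutation_of_cycle[of "j # cs"]] 1
    by (auto simp: sign_swap_id)
  then show ?case unfolding cycle_of_list.simps by (simp del: o_apply add: comp_def)
qed auto

lemma cycle_of_list_nth: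
  assumes "distinct xs" "j < length xs"
  shows "cycle_of_list xs (xs ! j) = xs ! (Suc j mod length xs)"
proof -
  have "map (cycle_of_list xs) xs ! j = rotate1 xs ! j"
    using cyclic_rotation[OF assms(1), of 1] by simp
  then show ?thesis using assms by (simp add: nth_rotate1)
qed

text \<open>A permutation with a non-zero term sends each \<open>i\<close> to \<open>i\<close> or to
  its successor. One fixed point forces its predecessor to be fixed, and so on round the whole
  cycle, which leaves only the identity and the full rotation.\<close>

lemma det_on_bidiagonal_cycle:
  assumes xs: "distinct xs" "2 \<le> length xs" and V: "V = set xs"
    and zero: "\<And>i j. i \<in> V \<Longrightarrow> j \<in> V \<Longrightarrow> j \<noteq> i \<Longrightarrow> j \<noteq> cycle_of_list xs i \<Longrightarrow> M i j = 0"
  shows "det_on V M = (\<Prod>i\<in>V. M i i) + (-1) ^ (length xs - 1) * (\<Prod>i\<in>V. M i (cycle_of_list xs i))"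
proof -
  define s where "s = cycle_of_list xs"
  define f where "f p = of_int (sign p) * (\<Prod>i\<in>V. M i (p i))" for p
  have s: "s permutes V" unfolding s_def V by (rule cycle_permutes)
  have nth: "s (xs ! j) = xs ! (Suc j mod length xs)" if "j < length xs" for j
    using cycle_of_list_nth[OF xs(1) that] by (simp add: s_def)
  have s_neq: "s i \<noteq> i" if i: "i \<in> V" for i
  proof -
    obtain j where j: "i = xs ! j" "j < length xs" using i V by (auto simp: in_set_conv_nth)
    have "Suc j mod length xs \<noteq> j" using j xs(2) by (cases "Suc j = length xs") auto
    moreover have "Suc j mod length xs < length xs" using j(2) by (intro mod_less_divisor) linarith
    ultimately show ?thesis using j nth xs by (auto simp: nth_eq_iff_index_eq)
  qed
  have only: "p = id \<or> p = s" if p: "p permutes V" and p_cases: "\<And>i. i \<in> V \<Longrightarrow> p i = i \<or> p i = s i" for p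
  proof -
    have inj: "inj p" using p by (rule permutes_inj)
    \<comment> \<open>If \<open>i\<close> moved, it would move to \<open>s i\<close>, which is
      already the image of \<open>s i\<close>.\<close>
    have pred_fixed: "p i = i" if "i \<in> V" "p (s i) = s i" for i
    proof (rule ccontr)
      assume "p i \<noteq> i"
      then have "p i = p (s i)" using p_cases that by metis
      then have "s i = i" using inj by (metis injD)
      then show False using s_neq that by simp
    qed
    have "p (xs ! j) = xs ! j" if m: "m < length xs" "p (xs ! m) = xs ! m" and j: "j < length xs" for m j
    proof -
      \<comment> \<open>Fixedness travels towards smaller indices. From index \<open>m\<close> it
        reaches 0, wraps round to the last index, and descending again from there reaches every
        \<open>j\<close>.\<close>
      have down: "p (xs ! (r - d)) = xs ! (r - d)"
        if "r < length xs" "p (xs ! r) = xs ! r" "d \<le> r" for r d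
        using that(3)
      proof (induction d)
        case (Suc d)
        have "s (xs ! (r - Suc d)) = xs ! (r - d)"
          using nth[of "r - Suc d"] that Suc.prems by (simp add: Suc_diff_Suc)
        moreover have "xs ! (r - Suc d) \<in> V" using that V by simp
        ultimately show ?case using pred_fixed[of "xs ! (r - Suc d)"] Suc.IH Suc.prems by simp
      qed (use that in simp)
      have "p (xs ! 0) = xs ! 0" using down[of m m] m by simp
      moreover have "Suc (length xs - 1) = length xs" using xs(2) by linarith
      then have "s (xs ! (length xs - 1)) = xs ! 0" using nth[of "length xs - 1"] by simp
      ultimately have "p (xs ! (length xs - 1)) = xs ! (length xs - 1)"
        using pred_fixed[of "xs ! (length xs - 1)"] xs(2) V by simp
      then show ?thesis using down[of "length xs - 1" "length xs - 1 - j"] j by simp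
    qed
    then have "(\<forall>i\<in>V. p i = i) \<or> (\<forall>i\<in>V. p i \<noteq> i)"
      unfolding V by (metis in_set_conv_nth)
    then show ?thesis
    proof
      assume "\<forall>i\<in>V. p i = i"
      then have "p x = id x" for x using permutes_not_in[OF p] by (cases "x \<in> V") auto
      then have "p = id" by (rule ext)
      then show ?thesis by simp
    next
      assume "\<forall>i\<in>V. p i \<noteq> i"
      then have "p x = s x" for x
        using p_cases[of x] permutes_not_in[OF p] permutes_not_in[OF s] by (cases "x \<in> V") auto
      then have "p = s" by (rule ext)
      then show ?thesis by simp
    qed
  qed
  have "V \<noteq> {}" using xs V by auto
  \<comment> \<open>The two surviving permutations must be different for the sum to have two
    separate terms.\<close>
  then have ne: "id \<noteq> s" using s_neq by force
  have "det_on V M = sum f {id, s}"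
    unfolding det_on_def f_def[symmetric]
  proof (rule sum.mono_neutral_right)
    show "\<forall>p\<in>{p. p permutes V} - {id, s}. f p = 0"
    proof
      fix p assume p: "p \<in> {p. p permutes V} - {id, s}"
      then obtain i where i: "i \<in> V" "p i \<noteq> i" "p i \<noteq> s i" using only by auto
      then have "M i (p i) = 0"
        using zero[of i "p i"] p permutes_in_image[of p V i] by (simp add: s_def)
      then show "f p = 0" using i V unfolding f_def by (auto intro!: prod_zero)
    qed
  qed (use s V in \<open>auto simp: finite_permutations permutes_id\<close>)
  then show ?thesis using ne sign_cycle_of_list[OF xs(1)] by (simp add: f_def s_def)
qed

section \<open>Oriented graphs, connectivity and cycles\<close>

lemma oriented_graphD:
  assumes "oriented_graph U"
  shows "finite (pverts U)" "finite (parcs U)" "pair_wf_digraph U"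
    and "(x, y) \<in> parcs U \<Longrightarrow> x \<in> pverts U \<and> y \<in> pverts U \<and> x \<noteq> y \<and> (y, x) \<notin> parcs U"
proof -
  interpret pair_digraph U using assms by (simp add: oriented_graph_def)
  show "finite (pverts U)" "finite (parcs U)" "pair_wf_digraph U" by auto
  show "(x, y) \<in> parcs U \<Longrightarrow> x \<in> pverts U \<and> y \<in> pverts U \<and> x \<noteq> y \<and> (y, x) \<notin> parcs U"
    using assms in_arcsD1 in_arcsD2 no_loops' by (auto simp: oriented_graph_def)
qed

lemma oriented_graphI:
  assumes "finite (pverts U)" "finite (parcs U)"
    and "\<And>x y. (x, y) \<in> parcs U \<Longrightarrow> x \<in> pverts U \<and> y \<in> pverts U \<and> x \<noteq> y \<and> (y, x) \<notin> parcs U"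
  shows "oriented_graph U"
proof -
  have "pair_digraph U"
    using assms(1,2) by unfold_locales (auto dest: assms(3))
  then show ?thesis using assms(3) by (auto simp: oriented_graph_def)
qed

lemma oriented_graph_mono:
  assumes "oriented_graph G" "pverts U \<subseteq> pverts G" "parcs U \<subseteq> parcs G"
    and "\<And>x y. (x, y) \<in> parcs U \<Longrightarrow> x \<in> pverts U \<and> y \<in> pverts U"
  shows "oriented_graph U"
proof (rule oriented_graphI)
  show "finite (pverts U)" "finite (parcs U)"
    using oriented_graphD(1,2)[OF assms(1)] assms(2,3) by (auto intro: finite_subset)
  show "x \<in> pverts U \<and> y \<in> pverts U \<and> x \<noteq> y \<and> (y, x) \<notin> parcs U"
    if "(x, y) \<in> parcs U" for x y
    using that oriented_graphD(4)[OF assms(1)] assms(3,4) by blast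
qed

lemma subgraph_with_proj_iff:
  "subgraph (with_proj H) (with_proj G) \<longleftrightarrow>
    pverts H \<subseteq> pverts G \<and> parcs H \<subseteq> parcs G \<and> pair_wf_digraph H \<and> pair_wf_digraph G"
  by (auto simp: subgraph_def wf_digraph_wp_iff)

lemma parcs_mk_symmetric_with_proj:
  "parcs (mk_symmetric (with_proj U)) = parcs U \<union> (parcs U)\<inverse>"
proof -
  have "(a, b) \<in> parcs (mk_symmetric (with_proj U)) \<longleftrightarrow> (a, b) \<in> parcs U \<union> (parcs U)\<inverse>" for a b
    unfolding parcs_mk_symmetric by (simp add: split_paired_Bex_Sigma Bex_def prod_eq_iff) blast
  then show ?thesis by (intro Set.set_eqI) (simp only: split_paired_all)
qed

text \<open>Everything reachable from a point of an arc-closed set stays in it; conversely, the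
  vertices reachable from \<open>u\<close> form an arc-closed set. All later connectivity arguments
  only exhibit such a set instead of building walks.\<close>

lemma weakly_connected_iff_cut:
  assumes "pair_wf_digraph U"
  shows "weakly_connected U \<longleftrightarrow> pverts U \<noteq> {} \<and>
    (\<forall>A \<subseteq> pverts U. A \<noteq> {} \<longrightarrow> (\<forall>(x, y) \<in> parcs U. x \<in> A \<longleftrightarrow> y \<in> A) \<longrightarrow> A = pverts U)"
    (is "?L \<longleftrightarrow> ?R")
proof -
  let ?R' = "rtrancl_on (pverts U) (parcs U \<union> (parcs U)\<inverse>)"
  have L: "?L \<longleftrightarrow> pverts U \<noteq> {} \<and> (\<forall>u\<in>pverts U. \<forall>v\<in>pverts U. (u, v) \<in> ?R')"
    unfolding connected_def strongly_connected_def reachable_def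
    by (simp add: parcs_mk_symmetric_with_proj)
  interpret pair_wf_digraph U by fact
  show ?thesis
  proof
    assume ?L
    have "A = pverts U" if A: "A \<subseteq> pverts U" "A \<noteq> {}"
      and closed: "\<forall>(x, y) \<in> parcs U. x \<in> A \<longleftrightarrow> y \<in> A" for A
    proof
      obtain a where a: "a \<in> A" using A by auto
      have "v \<in> A" if "(a, v) \<in> ?R'" for v
        using that
      proof (induction rule: rtrancl_on_induct)
        case (step y z)
        then show ?case using closed by auto
      qed (use a in simp)
      then show "pverts U \<subseteq> A" using a A L \<open>?L\<close> by blast
    qed fact
    moreover have "pverts U \<noteq> {}" using L \<open>?L\<close> by simp
    ultimately show ?R by simp
  next
    assume R: ?R
    have "(u, v) \<in> ?R'" if uv: "u \<in> pverts U" "v \<in> pverts U" for u v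
    proof -
      \<comment> \<open>The witness for the cut condition is the set of all vertices reachable from
        \<open>u\<close>.\<close>
      let ?A = "{x \<in> pverts U. (u, x) \<in> ?R'}"
      have "y \<in> ?A" if "(x, y) \<in> parcs U \<union> (parcs U)\<inverse>" "x \<in> ?A" for x y
        using that in_arcsD1 in_arcsD2 rtrancl_on_into_rtrancl_on[of u x "pverts U" _ y] by blast
      then have "\<forall>(x, y) \<in> parcs U. x \<in> ?A \<longleftrightarrow> y \<in> ?A" by blast
      moreover have "?A \<subseteq> pverts U" "?A \<noteq> {}" using uv by auto
      ultimately have "?A = pverts U" using conjunct2[OF R] by simp
      then show ?thesis using uv by auto
    qed
    then show ?L using L R by blast
  qed
qed

section \<open>Round trips along a cycle as cyclic lists of vertices\<close>

lemma pcas_imp_snoc: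
  "pcas u p v \<Longrightarrow> u # map snd p = map fst p @ [v]"
  by (induction p arbitrary: u) auto

lemma pcas_zip: "pcas x (zip (x # ys) (ys @ [v])) v"
  by (induction ys arbitrary: x) auto

lemma pawalk_verts_zip: "pawalk_verts x (zip (x # ys) (ys @ [v])) = x # ys @ [v]"
  by (induction ys arbitrary: x) auto

lemma pawalk_verts_pcas: "pcas u p v \<Longrightarrow> pawalk_verts u p = u # map snd p"
  by (induction p arbitrary: u) auto

text \<open>The walk is replaced by the list of its distinct vertices, on which
  \<open>cycle_of_list\<close> acts as the successor map; a cycle thereby becomes a permutation with
  known sign.\<close>

lemma goes_round_iff:
  "goes_round p C \<longleftrightarrow> (\<exists>xs. distinct xs \<and> 3 \<le> length xs \<and> p = zip xs (rotate1 xs) \<and>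
    pverts C = set xs \<and> parcs C \<union> (parcs C)\<inverse> = set p \<union> (set p)\<inverse>)"
proof
  assume "goes_round p C"
  then obtain u where u: "pcas u p u" and dist: "distinct (tl (pawalk_verts u p))"
    and len: "3 \<le> length p" and V: "pverts C = fst ` set p"
    and E: "parcs C \<union> (parcs C)\<inverse> = set p \<union> (set p)\<inverse>"
    unfolding goes_round_def pre_digraph.cycle_def pre_digraph.awalk_def
      awalk_verts_with_proj_eq cas_with_proj_eq parcs_mk_symmetric_with_proj by auto
  define xs where "xs = map fst p"
  \<comment> \<open>The vertex sequence of a closed walk, read once through the heads and once
    through the tails of its steps, shows that the heads are the tails rotated by one place.\<close>
  have snoc: "u # map snd p = xs @ [u]" using pcas_imp_snoc[OF u] by (simp add: xs_def)
  obtain y ys where xs: "xs = y # ys" using len by (cases xs) (auto simp: xs_def)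
  have snd: "map snd p = rotate1 xs" using snoc xs by auto
  have "p = zip xs (map snd p)" by (simp add: xs_def zip_map_fst_snd)
  then have "p = zip xs (rotate1 xs)" using snd by simp
  moreover have "distinct xs" using dist snd pawalk_verts_pcas[OF u] distinct1_rotate[of xs] by simp
  moreover have "3 \<le> length xs" "pverts C = set xs" using len V by (auto simp: xs_def)
  ultimately show "\<exists>xs. distinct xs \<and> 3 \<le> length xs \<and> p = zip xs (rotate1 xs) \<and>
    pverts C = set xs \<and> parcs C \<union> (parcs C)\<inverse> = set p \<union> (set p)\<inverse>" using E by blast
next
  assume "\<exists>xs. distinct xs \<and> 3 \<le> length xs \<and> p = zip xs (rotate1 xs) \<and>
    pverts C = set xs \<and> parcs C \<union> (parcs C)\<inverse> = set p \<union> (set p)\<inverse>"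
  then obtain xs where xs: "distinct xs" "3 \<le> length xs" "p = zip xs (rotate1 xs)"
    and V: "pverts C = set xs" and E: "parcs C \<union> (parcs C)\<inverse> = set p \<union> (set p)\<inverse>" by blast
  obtain y ys where y: "xs = y # ys" using xs(2) by (cases xs) auto
  have p: "p = zip (y # ys) (ys @ [y])" using xs y by simp
  have "pcas y p y" "pawalk_verts y p = y # ys @ [y]"
    unfolding p by (rule pcas_zip, rule pawalk_verts_zip)
  moreover have "map fst p = xs" using xs(3) by simp
  then have "fst ` set p = set xs" by (metis set_map)
  moreover have "length p = length xs" "p \<noteq> []" using p y xs(3) by auto
  moreover have "distinct (ys @ [y])" using xs(1) y by simp
  ultimately show "goes_round p C"
    unfolding goes_round_def pre_digraph.cycle_def pre_digraph.awalk_def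
      awalk_verts_with_proj_eq cas_with_proj_eq parcs_mk_symmetric_with_proj
    using xs(2) V E y
    by (intro conjI exI[of _ y]) (simp_all add: parcs_mk_symmetric_with_proj)
qed

lemma set_zip_rotate1:
  assumes "distinct xs"
  shows "set (zip xs (rotate1 xs)) = (\<lambda>x. (x, cycle_of_list xs x)) ` set xs"
proof -
  have "set (zip xs (rotate1 xs)) = (\<lambda>j. (xs ! j, xs ! (Suc j mod length xs))) ` {..<length xs}"
    by (auto simp: set_zip nth_rotate1)
  also have "\<dots> = (\<lambda>j. (xs ! j, cycle_of_list xs (xs ! j))) ` {..<length xs}"
    using cycle_of_list_nth[OF assms] by (intro image_cong) auto
  also have "\<dots> = (\<lambda>x. (x, cycle_of_list xs x)) ` set xs"
    by (auto simp: set_conv_nth)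
  finally show ?thesis .
qed

text \<open>Both claims come down to indices modulo the length. The second one says that the edge
  from \<open>x\<close> to its successor is not also the edge from the successor to
  \<open>x\<close>, so different vertices give different edges.\<close>

lemma cycle_of_list_no_fixpoint:
  assumes "distinct xs" "3 \<le> length xs" "x \<in> set xs"
  shows "cycle_of_list xs x \<noteq> x" "cycle_of_list xs (cycle_of_list xs x) \<noteq> x"
proof -
  let ?k = "length xs"
  obtain j where j: "x = xs ! j" "j < ?k" using assms(3) by (auto simp: in_set_conv_nth)
  have less: "m mod ?k < ?k" for m using assms(2) by (intro mod_less_divisor) linarith
  have 1: "Suc j mod ?k \<noteq> j" using j assms(2) by (cases "Suc j = ?k") auto
  have 2: "Suc (Suc j mod ?k) mod ?k \<noteq> j"
  proof (cases "Suc j = ?k")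
    case False
    then show ?thesis using j assms(2) by (cases "Suc (Suc j) = ?k") auto
  qed (use assms(2) in auto)
  show "cycle_of_list xs x \<noteq> x" "cycle_of_list xs (cycle_of_list xs x) \<noteq> x"
    using 1 2 j less assms(1) by (auto simp: cycle_of_list_nth nth_eq_iff_index_eq)
qed

lemma cycle_of_list_in_set: "x \<in> set xs \<Longrightarrow> cycle_of_list xs x \<in> set xs"
  using cycle_permutes[of xs] by (simp add: permutes_in_image)

definition incident_arcs :: "'a pair_pre_digraph \<Rightarrow> 'a \<Rightarrow> ('a \<times> 'a) set" where
  "incident_arcs U v = {e \<in> parcs U. fst e = v \<or> snd e = v}"

text \<open>This is the handshake identity, obtained by exchanging the sums over vertices and
  arcs.\<close>

lemma sum_card_incident_arcs:
  assumes "oriented_graph U"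
  shows "(\<Sum>v\<in>pverts U. card (incident_arcs U v)) = 2 * card (parcs U)"
proof -
  note U = oriented_graphD[OF assms]
  have "card (incident_arcs U v) =
      (\<Sum>e\<in>parcs U. (if v = fst e then 1 else 0) + (if v = snd e then 1 else 0))" for v
  proof -
    have "card (incident_arcs U v) = (\<Sum>e\<in>parcs U. if fst e = v \<or> snd e = v then 1 else 0)"
      using U(2) by (simp add: incident_arcs_def sum.If_cases Int_def)
    also have "\<dots> = (\<Sum>e\<in>parcs U. (if v = fst e then 1 else 0) + (if v = snd e then 1 else 0))"
      \<comment> \<open>Without loops at most one end of an arc is \<open>v\<close>, so the
        disjunction becomes a sum of two indicators.\<close>
      by (intro sum.cong refl) (use U(4) in fastforce)
    finally show ?thesis .
  qed
  then have "(\<Sum>v\<in>pverts U. card (incident_arcs U v)) = (\<Sum>v\<in>pverts U. \<Sum>e\<in>parcs U.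
      (if v = fst e then 1 else 0) + (if v = snd e then 1 else 0))"
    by simp
  also have "\<dots> = (\<Sum>e\<in>parcs U. \<Sum>v\<in>pverts U.
      (if v = fst e then 1 else 0) + (if v = snd e then 1 else 0))"
    by (rule sum.swap)
  also have "\<dots> = (\<Sum>e\<in>parcs U. 2)"
  proof (intro sum.cong refl)
    fix e assume "e \<in> parcs U"
    then have "fst e \<in> pverts U" "snd e \<in> pverts U" using U(4)[of "fst e" "snd e"] by auto
    then show "(\<Sum>v\<in>pverts U. (if v = fst e then 1 else 0) + (if v = snd e then 1 else 0)) = (2 :: nat)"
      using U(1) by (simp add: sum.distrib)
  qed
  finally show ?thesis by simp
qed

lemma graph_cycles_iff:
  assumes "pair_wf_digraph U"
  shows "C \<in> graph_cycles U \<longleftrightarrow> pverts C \<subseteq> pverts U \<and> parcs C \<subseteq> parcs U \<and> (\<exists>p. goes_round p C)"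
proof -
  have "pair_wf_digraph C" if "goes_round p C" for p
  proof -
    obtain xs where xs: "p = zip xs (rotate1 xs)" "pverts C = set xs"
      "parcs C \<union> (parcs C)\<inverse> = set p \<union> (set p)\<inverse>"
      using \<open>goes_round p C\<close> unfolding goes_round_iff by blast
    have "x \<in> pverts C \<and> y \<in> pverts C" if "(x, y) \<in> parcs C" for x y
    proof -
      have "(x, y) \<in> set p \<or> (y, x) \<in> set p" using that xs(3) by blast
      then show ?thesis unfolding xs(1,2) by (metis set_rotate1 set_zip_leftD set_zip_rightD)
    qed
    then show ?thesis by unfold_locales auto
  qed
  then show ?thesis using assms unfolding graph_cycles_def subgraph_with_proj_iff by blast
qed

lemma goes_round_wf:
  assumes "C \<in> graph_cycles U" "(x, y) \<in> parcs C"
  shows "x \<in> pverts C" "y \<in> pverts C"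
  using assms by (auto simp: graph_cycles_def subgraph_with_proj_iff
    dest: pair_wf_digraph.in_arcsD1 pair_wf_digraph.in_arcsD2)

text \<open>The step leaving \<open>v\<close> and the step arriving at \<open>v\<close> use
  different edges, since predecessor, \<open>v\<close> and successor are three different vertices.
  This keeps leaves off cycles and shows that a cycle in a two-regular graph uses every arc at its
  vertices.\<close>

lemma two_incident_arcs_of_cycle:
  assumes "C \<in> graph_cycles U" "finite (parcs C)" "v \<in> pverts C"
  shows "2 \<le> card (incident_arcs C v)"
proof -
  obtain xs where xs: "distinct xs" "3 \<le> length xs" "pverts C = set xs"
    "parcs C \<union> (parcs C)\<inverse> = set (zip xs (rotate1 xs)) \<union> (set (zip xs (rotate1 xs)))\<inverse>"
    using assms(1) unfolding graph_cycles_def goes_round_iff by blast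
  let ?s = "cycle_of_list xs"
  have "?s ` set xs = set xs" using cycle_is_surj[OF xs(1)] .
  then obtain u where u: "u \<in> set xs" "?s u = v" using assms(3) xs(3) by (metis imageE)
  have "(v, ?s v) \<in> parcs C \<union> (parcs C)\<inverse>" "(u, v) \<in> parcs C \<union> (parcs C)\<inverse>"
    using assms(3) u unfolding xs(3,4) set_zip_rotate1[OF xs(1)] by auto
  then obtain e f where e: "e \<in> parcs C" "e = (v, ?s v) \<or> e = (?s v, v)"
    and f: "f \<in> parcs C" "f = (u, v) \<or> f = (v, u)" by auto
  have "u \<noteq> v" "?s v \<noteq> v" "?s v \<noteq> u"
    using cycle_of_list_no_fixpoint[OF xs(1,2)] u assms(3) xs(3) by metis+
  then have "e \<noteq> f" using e f by auto
  then have "card {e, f} = 2" by simp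
  moreover have "{e, f} \<subseteq> incident_arcs C v" using e f by (auto simp: incident_arcs_def)
  moreover have "finite (incident_arcs C v)" using assms(2) by (simp add: incident_arcs_def)
  ultimately show ?thesis by (metis card_mono)
qed

section \<open>The incidence factorisation\<close>

text \<open>The whole phase of \<open>w e\<close> is put at the tail; the head entry is a
  non-negative real.\<close>

definition incidence :: "('a \<times> 'a \<Rightarrow> complex) \<Rightarrow> 'a \<Rightarrow> 'a \<times> 'a \<Rightarrow> complex" where
  "incidence w i e =
     (if i = fst e then w e / complex_of_real (sqrt (cmod (w e)))
      else if i = snd e then complex_of_real (sqrt (cmod (w e)))
      else 0)"

definition gram :: "('a \<times> 'a \<Rightarrow> complex) \<Rightarrow> ('a \<times> 'a) set \<Rightarrow> 'a \<Rightarrow> 'a \<Rightarrow> complex" where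
  "gram w E i j = (\<Sum>e\<in>E. incidence w i e * cnj (incidence w j e))"

lemma incidence_eq_0: "i \<noteq> fst e \<Longrightarrow> i \<noteq> snd e \<Longrightarrow> incidence w i e = 0"
  by (simp add: incidence_def)

lemma incidence_nonzero: "w e \<noteq> 0 \<Longrightarrow> i = fst e \<or> i = snd e \<Longrightarrow> incidence w i e \<noteq> 0"
  by (auto simp: incidence_def)

lemma incidence_tail_head:
  assumes "u \<noteq> v" "w (u, v) \<noteq> 0"
  shows "incidence w u (u, v) * cnj (incidence w v (u, v)) = w (u, v)"
  using assms by (simp add: incidence_def)

lemma incidence_mult_cnj:
  assumes "w e \<noteq> 0" "i = fst e \<or> i = snd e"
  shows "incidence w i e * cnj (incidence w i e) = complex_of_real (cmod (w e))"
proof -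
  have "cmod (incidence w i e) = sqrt (cmod (w e))"
    using assms by (auto simp: incidence_def norm_divide real_div_sqrt)
  then have "(cmod (incidence w i e))\<^sup>2 = cmod (w e)" by simp
  then show ?thesis by (simp only: complex_norm_square[symmetric])
qed

text \<open>An arc traversed backwards contributes the conjugate weight, and conjugation swaps the
  roles of tail and head in the product. The formula therefore does not depend on the direction of
  \<open>e\<close>, and cycle weights can be computed along a round trip that ignores
  directions.\<close>

lemma adj_entry_incidence:
  assumes "oriented_graph G" "e \<in> parcs G" "w e \<noteq> 0" "e = (u, v) \<or> e = (v, u)"
  shows "adj_entry G w u v = incidence w u e * cnj (incidence w v e)"
proof -
  have "(v, u) \<notin> parcs G \<or> (u, v) \<notin> parcs G" "u \<noteq> v"
    using assms(2,4) oriented_graphD(4)[OF assms(1)] by blast+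
  moreover have "cnj (w (v, u)) = incidence w u (v, u) * cnj (incidence w v (v, u))" if "e = (v, u)"
    using incidence_tail_head[of v u w] that assms(3) \<open>u \<noteq> v\<close>
    by (metis complex_cnj_cnj complex_cnj_mult mult.commute)
  ultimately show ?thesis
    using assms(2-4) incidence_tail_head[of u v w] by (auto simp: adj_entry_def)
qed

lemma gram_eq_0:
  assumes "\<And>e. e \<in> E \<Longrightarrow> \<not> ((i = fst e \<or> i = snd e) \<and> (j = fst e \<or> j = snd e))"
  shows "gram w E i j = 0"
  unfolding gram_def
proof (intro sum.neutral ballI)
  fix e assume "e \<in> E"
  then show "incidence w i e * cnj (incidence w j e) = 0"
    using assms[of e] incidence_eq_0[of i e w] incidence_eq_0[of j e w] by auto
qed

text \<open>Only the column of \<open>e\<close> is non-zero at \<open>v\<close>, so row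
  \<open>v\<close> is a multiple of that conjugated column. Subtracting a suitable multiple of row
  \<open>v\<close> from row \<open>u\<close> erases \<open>e\<close> from row \<open>u\<close>;
  column \<open>v\<close> is then zero outside its diagonal entry, which has the value
  \<open>|w e|\<close>.\<close>

lemma det_gram_remove_leaf:
  assumes fin: "finite V" "finite E" and e: "e \<in> E" "e = (u, v) \<or> e = (v, u)" "w e \<noteq> 0"
    and uv: "u \<in> V" "v \<in> V" "u \<noteq> v"
    and leaf: "\<And>f. f \<in> E - {e} \<Longrightarrow> fst f \<noteq> v \<and> snd f \<noteq> v"
  shows "det_on V (gram w E) = complex_of_real (cmod (w e)) * det_on (V - {v}) (gram w (E - {e}))"
proof -
  \<comment> \<open>This factor cancels the contribution of \<open>e\<close> to row \<open>u\<close>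
    in all columns at once.\<close>
  define c where "c = - (incidence w u e / incidence w v e)"
  define N where "N i j = (if i = u then gram w E u j + c * gram w E v j else gram w E i j)" for i j
  have split: "gram w E i j = incidence w i e * cnj (incidence w j e) + gram w (E - {e}) i j" for i j
    unfolding gram_def using fin e(1) by (subst sum.remove[of E e]) auto
  have v0: "gram w (E - {e}) i j = 0" if "i = v \<or> j = v" for i j
    using leaf that by (intro gram_eq_0) blast
  have nz: "incidence w v e \<noteq> 0" using e by (intro incidence_nonzero) auto
  have N: "N i j = gram w (E - {e}) i j" if "i \<noteq> v" for i j
  proof (cases "i = u")
    case True
    then show ?thesis using nz v0[of v j] by (simp add: N_def split c_def)
  next
    case False
    then have "incidence w i e = 0" using that e(2) by (intro incidence_eq_0) auto
    then show ?thesis using False by (simp add: N_def split)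
  qed
  have "det_on V (gram w E) = det_on V N"
    by (rule det_on_add_row_multiple[OF fin(1) uv, of N _ c, symmetric]) (simp add: N_def)
  also have "\<dots> = det_on ({v} \<union> (V - {v})) N" using uv by (simp add: insert_absorb)
  also have "\<dots> = det_on {v} N * det_on (V - {v}) N"
    using fin N v0 by (intro det_on_block_triangular) auto
  also have "det_on {v} N = complex_of_real (cmod (w e))"
    using uv v0[of v v] incidence_mult_cnj[of w e v] e(2,3) by (auto simp: N_def split)
  also have "det_on (V - {v}) N = det_on (V - {v}) (gram w (E - {e}))"
    using N by (intro det_on_cong) auto
  finally show ?thesis .
qed

lemma det_on_cnj: "det_on V (\<lambda>i j. cnj (M i j)) = cnj (det_on V M)"
  by (simp add: det_on_def)

text \<open>Labelling the edge from \<open>x\<close> to its successor by \<open>x\<close> turns the incidence matrix of a cycle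
  into a square matrix with two nonzero diagonals.\<close>

lemma det_gram_cycle:
  assumes G: "oriented_graph G" and C: "goes_round p C" "parcs C \<subseteq> parcs G"
    and nz: "\<And>e. e \<in> parcs G \<Longrightarrow> w e \<noteq> 0"
  shows "det_on (pverts C) (gram w (parcs C)) = complex_of_real (2 * cycle_alpha G w C)"
proof -
  \<comment> \<open>\<open>q\<close> is the very walk that \<open>cycle_wt\<close> chooses, so the
    weight is computed along \<open>q\<close>; the given \<open>p\<close> only ensures that such a
    walk exists.\<close>
  define q where "q = (SOME p. goes_round p C)"
  have "goes_round q C" using C(1) unfolding q_def by (rule someI)
  then obtain xs where xs: "distinct xs" "3 \<le> length xs" "pverts C = set xs"
    and q: "q = zip xs (rotate1 xs)"
    and E: "parcs C \<union> (parcs C)\<inverse> = set (zip xs (rotate1 xs)) \<union> (set (zip xs (rotate1 xs)))\<inverse>"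
    unfolding goes_round_iff by blast
  define V where "V = set xs"
  define s where "s = cycle_of_list xs"
  \<comment> \<open>The label of \<open>x\<close> is the arc between \<open>x\<close> and its
    successor, in whichever direction it occurs in \<open>C\<close>.\<close>
  define lab where "lab x = (if (x, s x) \<in> parcs C then (x, s x) else (s x, x))" for x
  have sV: "s x \<in> V" if "x \<in> V" for x using that cycle_of_list_in_set by (auto simp: V_def s_def)
  have s: "s x \<noteq> x" "s (s x) \<noteq> x" if "x \<in> V" for x
    using cycle_of_list_no_fixpoint[OF xs(1,2)] that unfolding V_def s_def by blast+
  have E': "parcs C \<union> (parcs C)\<inverse> = (\<lambda>x. (x, s x)) ` V \<union> ((\<lambda>x. (x, s x)) ` V)\<inverse>"
    using E unfolding set_zip_rotate1[OF xs(1)] V_def s_def .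
  have lab_in: "lab x \<in> parcs C" if "x \<in> V" for x
  proof -
    have "(x, s x) \<in> parcs C \<union> (parcs C)\<inverse>" unfolding E' using that by (intro UnI1 imageI)
    then show ?thesis by (auto simp: lab_def)
  qed
  have lab_cases: "lab x = (x, s x) \<or> lab x = (s x, x)" for x by (simp add: lab_def)
  have inj: "inj_on lab V"
  proof (rule inj_onI)
    fix x y assume xy: "x \<in> V" "y \<in> V" "lab x = lab y"
    \<comment> \<open>Equal labels at different vertices would make each the successor of the other,
      which a cycle of length at least 3 excludes.\<close>
    then have "x = y \<or> (x = s y \<and> s x = y)" using lab_cases[of x] lab_cases[of y] by (metis prod.inject)
    then show "x = y" using s(2)[OF xy(2)] by metis
  qed
  have "parcs C \<subseteq> lab ` V"
  proof clarify
    fix a b assume ab: "(a, b) \<in> parcs C"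
    then have "(a, b) \<in> (\<lambda>x. (x, s x)) ` V \<union> ((\<lambda>x. (x, s x)) ` V)\<inverse>" unfolding E'[symmetric] by blast
    then obtain x where x: "x \<in> V" "(a, b) = (x, s x) \<or> (a, b) = (s x, x)" by auto
    have "(b, a) \<notin> parcs C" using ab C(2) oriented_graphD(4)[OF G] by blast
    then have "lab x = (a, b)" using x(2) ab by (auto simp: lab_def)
    then show "(a, b) \<in> lab ` V" using x(1) by (metis imageI)
  qed
  then have lab_image: "parcs C = lab ` V" using lab_in by auto
  \<comment> \<open>Rows stand for arcs, through their labels, and columns for vertices, so this is
    the transposed incidence matrix. Row \<open>x\<close> is supported on the columns
    \<open>x\<close> and \<open>s x\<close>.\<close>
  define B where "B x i = incidence w i (lab x)" for x i
  have Bdet: "det_on V B = (\<Prod>x\<in>V. B x x) + (-1) ^ (length xs - 1) * (\<Prod>x\<in>V. B x (s x))"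
    unfolding s_def
  proof (rule det_on_bidiagonal_cycle)
    show "B i j = 0" if "j \<noteq> i" "j \<noteq> cycle_of_list xs i" for i j
      using that lab_cases[of i] unfolding B_def s_def by (intro incidence_eq_0) auto
  qed (use xs in \<open>auto simp: V_def\<close>)
  have "det_on V (gram w (parcs C)) = det_on V (\<lambda>i j. \<Sum>x\<in>V. B x i * cnj (B x j))"
    unfolding gram_def lab_image B_def by (simp add: sum.reindex[OF inj])
  also have "\<dots> = det_on V (\<lambda>i x. B x i) * det_on V (\<lambda>j x. cnj (B x j))"
    by (rule det_on_mult) (simp add: V_def)
  also have "\<dots> = det_on V B * cnj (det_on V B)"
    using det_on_transpose[of V B] det_on_transpose[of V "\<lambda>x j. cnj (B x j)"]
    by (simp add: det_on_cnj V_def)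
  also have "\<dots> = complex_of_real (2 * cycle_alpha G w C)"
  proof -
    define P where "P = (\<Prod>x\<in>V. B x x)"
    define P' where "P' = (\<Prod>x\<in>V. B x (s x))"
    define W where "W = cycle_wt G w C"
    define \<sigma> :: complex where "\<sigma> = (-1) ^ (length xs - 1)"
    have ends: "x = fst (lab x) \<or> x = snd (lab x)" "s x = fst (lab x) \<or> s x = snd (lab x)" for x
      by (auto simp: lab_def)
    have nz': "w (lab x) \<noteq> 0" if "x \<in> V" for x
      using nz[OF subsetD[OF C(2) lab_in[OF that]]] .
    have "map s xs = rotate1 xs" using cyclic_rotation[OF xs(1), of 1] by (simp add: s_def)
    moreover have "zip ys (map s ys) = map (\<lambda>x. (x, s x)) ys" for ys by (induction ys) auto
    ultimately have "zip xs (rotate1 xs) = map (\<lambda>x. (x, s x)) xs" by metis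
    then have "W = (\<Prod>x\<in>V. adj_entry G w x (s x))"
      unfolding W_def cycle_wt_def q_def[symmetric] q walk_wt_def V_def prod.distinct_set_conv_list[OF xs(1)]
      by (simp add: comp_def)
    also have "\<dots> = (\<Prod>x\<in>V. B x x * cnj (B x (s x)))"
      unfolding B_def
      by (intro prod.cong refl adj_entry_incidence[OF G] nz' lab_cases subsetD[OF C(2)] lab_in)
    finally have W: "W = P * cnj P'" by (simp add: P_def P'_def prod.distrib)
    have "(\<Prod>x\<in>V. B x x * cnj (B x x)) = (\<Prod>x\<in>V. complex_of_real (cmod (w (lab x))))"
      unfolding B_def by (intro prod.cong refl incidence_mult_cnj nz' ends)
    then have PP: "P * cnj P = complex_of_real (\<Prod>x\<in>V. cmod (w (lab x)))"
      by (simp add: P_def prod.distrib)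
    have "(\<Prod>x\<in>V. B x (s x) * cnj (B x (s x))) = (\<Prod>x\<in>V. complex_of_real (cmod (w (lab x))))"
      unfolding B_def by (intro prod.cong refl incidence_mult_cnj nz' ends)
    then have PP': "P' * cnj P' = complex_of_real (\<Prod>x\<in>V. cmod (w (lab x)))"
      by (simp add: P'_def prod.distrib)
    \<comment> \<open>The two entries of a row are the two ends of one arc and have the same
      modulus. Hence \<open>P\<close> and \<open>P'\<close> have equal modulus, and
      \<open>|W| = |P| |P'|\<close> is the product of the moduli of the weights.\<close>
    have eq: "(cmod P)\<^sup>2 = (cmod P')\<^sup>2" "(cmod P)\<^sup>2 = (\<Prod>x\<in>V. cmod (w (lab x)))"
      using PP PP' by (simp_all only: complex_norm_square[symmetric] of_real_eq_iff)
    then have "cmod P = cmod P'" by simp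
    then have modW: "cmod W = (\<Prod>x\<in>V. cmod (w (lab x)))"
      using eq(2) W by (simp add: norm_mult power2_eq_square)
    have \<sigma>: "cnj \<sigma> = \<sigma>" "\<sigma> * \<sigma> = 1" by (simp_all add: \<sigma>_def)
    have card: "card (parcs C) = length xs"
      unfolding lab_image card_image[OF inj] using xs(1) by (simp add: V_def distinct_card)
    have "det_on V B * cnj (det_on V B) = (P + \<sigma> * P') * (cnj P + \<sigma> * cnj P')"
      using Bdet \<sigma>(1) by (simp add: P_def P'_def \<sigma>_def)
    \<comment> \<open>The two square terms give \<open>|W|\<close> each, and the mixed terms are
      \<open>W\<close> plus its conjugate, that is \<open>2 Re W\<close>.\<close>
    also have "\<dots> = P * cnj P + (\<sigma> * \<sigma>) * (P' * cnj P') + \<sigma> * (P * cnj P' + cnj (P * cnj P'))"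
      by (simp add: algebra_simps)
    also have "\<dots> = complex_of_real (2 * cmod W) + \<sigma> * complex_of_real (2 * Re W)"
      by (simp only: \<sigma>(2) complex_add_cnj PP PP' modW flip: W) simp
    also have "\<dots> = complex_of_real (2 * cycle_alpha G w C)"
    proof (cases "even (length xs)")
      case True
      then have "odd (length xs - 1)" using xs(2) by (cases "length xs") auto
      then have "\<sigma> = -1" by (simp add: \<sigma>_def)
      then show ?thesis using True by (simp add: cycle_alpha_def even_cycle_def card W_def)
    next
      case False
      then have "\<sigma> = 1" using xs(2) by (simp add: \<sigma>_def)
      then show ?thesis using False by (simp add: cycle_alpha_def even_cycle_def card W_def)
    qed
    finally show ?thesis .
  qed
  finally show ?thesis by (simp add: V_def xs(3))
qed

section \<open>Leaves and two-regular graphs\<close>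

definition remove_vertex :: "'a pair_pre_digraph \<Rightarrow> 'a \<Rightarrow> 'a pair_pre_digraph" where
  "remove_vertex U v = \<lparr>pverts = pverts U - {v}, parcs = parcs U - incident_arcs U v\<rparr>"

lemma oriented_graph_remove_vertex:
  assumes "oriented_graph U"
  shows "oriented_graph (remove_vertex U v)"
  by (intro oriented_graph_mono[OF assms])
    (auto simp: remove_vertex_def incident_arcs_def dest: oriented_graphD(4)[OF assms])

lemma leaf_neighbour:
  assumes "oriented_graph U" "incident_arcs U v = {e}"
  obtains u where "u \<in> pverts U" "v \<in> pverts U" "u \<noteq> v" "e \<in> parcs U" "e = (u, v) \<or> e = (v, u)"
proof -
  obtain a b where ab: "e = (a, b)" by (cases e)
  have "e \<in> incident_arcs U v" using assms(2) by simp
  then have e: "e \<in> parcs U" "a = v \<or> b = v" by (auto simp: incident_arcs_def ab)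
  then have "a \<in> pverts U" "b \<in> pverts U" "a \<noteq> b" using oriented_graphD(4)[OF assms(1)] ab by blast+
  then show thesis using that[of a] that[of b] e ab by auto
qed

text \<open>An arc-closed set \<open>A\<close> of the smaller graph becomes arc-closed in
  \<open>U\<close> by adding \<open>v\<close> exactly when the neighbour \<open>u\<close> lies in
  \<open>A\<close>, so the cut criterion for \<open>U\<close> applies.\<close>

lemma weakly_connected_remove_leaf:
  assumes U: "oriented_graph U" "weakly_connected U" and leaf: "incident_arcs U v = {e}"
  shows "weakly_connected (remove_vertex U v)"
proof -
  obtain u where u: "u \<in> pverts U" "v \<in> pverts U" "u \<noteq> v" "e \<in> parcs U" "e = (u, v) \<or> e = (v, u)"
    using leaf_neighbour[OF U(1) leaf] .
  have cut: "A = pverts U" if "A \<subseteq> pverts U" "A \<noteq> {}"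
      "\<And>x y. (x, y) \<in> parcs U \<Longrightarrow> x \<in> A \<longleftrightarrow> y \<in> A" for A
  proof -
    have "\<forall>(x, y)\<in>parcs U. x \<in> A \<longleftrightarrow> y \<in> A" using that(3) by blast
    then show ?thesis
      using U(2) that(1,2) unfolding weakly_connected_iff_cut[OF oriented_graphD(3)[OF U(1)]] by simp
  qed
  have arcs: "(x, y) = e \<or> (x, y) \<in> parcs (remove_vertex U v) \<and> x \<noteq> v \<and> y \<noteq> v"
    if "(x, y) \<in> parcs U" for x y
  proof -
    have "(x, y) \<in> incident_arcs U v \<longleftrightarrow> x = v \<or> y = v" using that by (auto simp: incident_arcs_def)
    then show ?thesis using that leaf by (auto simp: remove_vertex_def)
  qed
  show ?thesis
    unfolding weakly_connected_iff_cut[OF oriented_graphD(3)[OF oriented_graph_remove_vertex[OF U(1)]]]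
  proof (intro conjI allI impI)
    show "pverts (remove_vertex U v) \<noteq> {}" using u by (auto simp: remove_vertex_def)
    fix A assume A: "A \<subseteq> pverts (remove_vertex U v)" "A \<noteq> {}"
      and closed: "\<forall>(x, y)\<in>parcs (remove_vertex U v). x \<in> A \<longleftrightarrow> y \<in> A"
    have AU: "A \<subseteq> pverts U" "v \<notin> A" using A(1) by (auto simp: remove_vertex_def)
    show "A = pverts (remove_vertex U v)"
    proof (cases "u \<in> A")
      case True
      have "insert v A = pverts U"
      proof (rule cut)
        show "x \<in> insert v A \<longleftrightarrow> y \<in> insert v A" if "(x, y) \<in> parcs U" for x y
          using arcs[OF that] closed u(5) True by auto
      qed (use AU u in auto)
      then show ?thesis using AU by (auto simp: remove_vertex_def)
    next
      case False
      have "A = pverts U"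
      proof (rule cut)
        show "x \<in> A \<longleftrightarrow> y \<in> A" if "(x, y) \<in> parcs U" for x y
          using arcs[OF that] closed u(5) False AU(2) by auto
      qed (use AU A in auto)
      then show ?thesis using AU u by auto
    qed
  qed
qed

text \<open>A vertex on a cycle has two incident arcs, so a leaf and its only arc lie on no
  cycle.\<close>

lemma graph_cycles_remove_leaf:
  assumes U: "oriented_graph U" and leaf: "incident_arcs U v = {e}"
  shows "graph_cycles (remove_vertex U v) = graph_cycles U"
    and "C \<in> graph_cycles U \<Longrightarrow> e \<notin> parcs C"
proof -
  note wf = oriented_graphD(3)[OF U] oriented_graphD(3)[OF oriented_graph_remove_vertex[OF U, of v]]
  have avoid: "v \<notin> pverts C" if C: "C \<in> graph_cycles U" for C
  proof
    assume "v \<in> pverts C"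
    have sub: "parcs C \<subseteq> parcs U" using C graph_cycles_iff[OF wf(1)] by blast
    then have fin: "finite (parcs C)" using oriented_graphD(2)[OF U] finite_subset by blast
    have "2 \<le> card (incident_arcs C v)"
      by (rule two_incident_arcs_of_cycle[OF C fin \<open>v \<in> pverts C\<close>])
    also have "\<dots> \<le> card (incident_arcs U v)"
      using sub leaf by (intro card_mono) (auto simp: incident_arcs_def)
    finally show False using leaf by simp
  qed
  have avoid_arcs: "parcs C \<inter> incident_arcs U v = {}" if C: "C \<in> graph_cycles U" for C
    using avoid[OF C] goes_round_wf[OF C] by (auto simp: incident_arcs_def)
  then show "C \<in> graph_cycles U \<Longrightarrow> e \<notin> parcs C" using leaf by auto
  show "graph_cycles (remove_vertex U v) = graph_cycles U"
  proof (rule equalityI; rule subsetI)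
    fix C assume "C \<in> graph_cycles (remove_vertex U v)"
    then show "C \<in> graph_cycles U"
      unfolding graph_cycles_iff[OF wf(1)] graph_cycles_iff[OF wf(2)]
      by (auto simp: remove_vertex_def)
  next
    fix C assume C: "C \<in> graph_cycles U"
    then show "C \<in> graph_cycles (remove_vertex U v)"
      using avoid[OF C] avoid_arcs[OF C]
      unfolding graph_cycles_iff[OF wf(1)] graph_cycles_iff[OF wf(2)]
      by (auto simp: remove_vertex_def)
  qed
qed

text \<open>The initial vertex of a longest path has all its neighbours on the path, and its
  second incident arc closes a cycle.\<close>

lemma cycle_exists:
  assumes U: "oriented_graph U" "pverts U \<noteq> {}"
    and deg: "\<And>v. v \<in> pverts U \<Longrightarrow> 2 \<le> card (incident_arcs U v)"
  shows "graph_cycles U \<noteq> {}"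
proof -
  note ori = oriented_graphD[OF U(1)]
  define adj where "adj x y \<longleftrightarrow> (x, y) \<in> parcs U \<or> (y, x) \<in> parcs U" for x y
  define paths where "paths = {xs. xs \<noteq> [] \<and> distinct xs \<and> set xs \<subseteq> pverts U \<and> successively adj xs}"
  obtain v0 where "v0 \<in> pverts U" using U(2) by auto
  then have "[v0] \<in> paths" by (simp add: paths_def)
  moreover have "length xs \<le> card (pverts U)" if "xs \<in> paths" for xs
  proof -
    have "distinct xs" "set xs \<subseteq> pverts U" using that by (simp_all add: paths_def)
    then show ?thesis using card_mono[OF ori(1)] distinct_card by metis
  qed
  \<comment> \<open>A longest path exists because path lengths are bounded by the number of
    vertices; \<open>Suc\<close> makes that bound strict.\<close>
  ultimately have "\<exists>xs. xs \<in> paths \<and> (\<forall>ys. ys \<in> paths \<longrightarrow> length ys \<le> length xs)"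
    by (intro ex_has_greatest_nat[of _ "[v0]" _ "Suc (card (pverts U))"]) (auto simp: less_Suc_eq_le)
  then obtain xs where xs: "xs \<in> paths" and max: "\<And>ys. ys \<in> paths \<Longrightarrow> length ys \<le> length xs"
    by blast
  obtain x ys where x: "xs = x # ys" using xs by (cases xs) (auto simp: paths_def)
  have nbr: "y \<in> set xs \<and> y \<noteq> x" if "adj x y" for y
  proof -
    have y: "y \<in> pverts U" "y \<noteq> x" using that ori(4) unfolding adj_def by blast+
    have "y \<in> set xs"
    proof (rule ccontr)
      assume "y \<notin> set xs"
      moreover have "adj y x" using that by (auto simp: adj_def)
      ultimately have "y # xs \<in> paths" using xs y by (simp add: paths_def x)
      then show False using max[of "y # xs"] by simp
    qed
    then show ?thesis using y by simp
  qed
  have "x \<in> pverts U" using xs by (simp add: paths_def x)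
  then have "2 \<le> card (incident_arcs U x)" by (rule deg)
  then obtain e f where ef: "e \<in> incident_arcs U x" "f \<in> incident_arcs U x" "e \<noteq> f"
  proof -
    have "finite (incident_arcs U x)" using ori(2) by (simp add: incident_arcs_def)
    moreover have "\<not> card (incident_arcs U x) \<le> Suc 0"
      using \<open>2 \<le> card (incident_arcs U x)\<close> by simp
    ultimately show thesis using that by (auto simp: card_le_Suc0_iff_eq)
  qed
  have ends: "\<exists>y. adj x y \<and> (g = (x, y) \<or> g = (y, x))" if "g \<in> incident_arcs U x" for g
    using that by (cases g) (auto simp: adj_def incident_arcs_def)
  obtain y1 where y1: "adj x y1" "e = (x, y1) \<or> e = (y1, x)" using ends[OF ef(1)] by blast
  obtain y2 where y2: "adj x y2" "f = (x, y2) \<or> f = (y2, x)" using ends[OF ef(2)] by blast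
  have "y1 \<noteq> y2"
  proof
    assume "y1 = y2"
    moreover have "e \<in> parcs U" "f \<in> parcs U" using ef by (simp_all add: incident_arcs_def)
    ultimately have "(x, y1) \<in> parcs U \<and> (y1, x) \<in> parcs U"
      using y1(2) y2(2) ef(3) by metis
    then show False using ori(4) by blast
  qed
  \<comment> \<open>Of two different neighbours of \<open>x\<close>, at least one is not the next
    vertex on the path. It has index at least 1 in \<open>ys\<close>, so the closed list
    \<open>zs\<close> has three or more vertices.\<close>
  then obtain y where y: "adj x y" "y \<noteq> hd ys" using y1(1) y2(1) by metis
  then obtain j where j: "j < length ys" "y = ys ! j" 
  proof -
    have "y \<in> set ys" using nbr[OF y(1)] unfolding x by auto
    then show thesis using that by (metis in_set_conv_nth)
  qed
  have "ys \<noteq> []" using j by auto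
  then have "j \<noteq> 0" using y(2) j(2) hd_conv_nth[of ys] by metis
  define zs where "zs = x # take (Suc j) ys"
  have len: "length zs = Suc (Suc j)" using j by (simp add: zs_def)
  have zs_take: "zs = take (Suc (Suc j)) xs" by (simp add: zs_def x)
  have dist: "distinct zs" and sub: "set zs \<subseteq> pverts U"
    using xs set_take_subset[of "Suc (Suc j)" xs] by (auto simp: zs_take paths_def)
  have zs_nth: "zs ! i = xs ! i" if "i < Suc (Suc j)" for i using that by (simp add: zs_take)
  define cyc where "cyc = set (zip zs (rotate1 zs))"
  have cyc_adj: "adj a b" if ab: "(a, b) \<in> cyc" for a b
  proof -
    obtain i where i: "i < length zs" "a = zs ! i" "b = zs ! (Suc i mod length zs)"
    proof -
      have "(a, b) \<in> set (zip zs (rotate1 zs))" using ab by (simp add: cyc_def)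
      then obtain i where "i < length zs" "zs ! i = a" "rotate1 zs ! i = b" by (auto simp: in_set_zip)
      then show thesis using that by (auto simp: nth_rotate1)
    qed
    show ?thesis
    proof (cases "Suc i = length zs")
      case True
      \<comment> \<open>Index \<open>Suc j\<close> of \<open>xs\<close> is index \<open>j\<close> of
        \<open>ys\<close>, so the closing step runs from \<open>y\<close> back to
        \<open>x\<close>.\<close>
      then have "b = zs ! 0" "a = xs ! Suc j" using i len zs_nth by auto
      then have "a = y" "b = x" using j(2) by (simp_all add: zs_def x)
      then show ?thesis using y(1) by (auto simp: adj_def)
    next
      case False
      then have "a = xs ! i" "b = xs ! Suc i" using i len by (auto simp: zs_nth)
      moreover have "Suc i < length xs" using False i len j by (simp add: x)
      ultimately show ?thesis using xs by (simp add: paths_def successively_conv_nth)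
    qed
  qed
  \<comment> \<open>Each step of the round trip is kept in the direction that it has in
    \<open>U\<close>.\<close>
  define C where "C = \<lparr>pverts = set zs, parcs = parcs U \<inter> (cyc \<union> cyc\<inverse>)\<rparr>"
  have "parcs C \<union> (parcs C)\<inverse> = cyc \<union> cyc\<inverse>"
    using cyc_adj unfolding C_def adj_def by auto
  then have "goes_round (zip zs (rotate1 zs)) C"
    unfolding goes_round_iff using dist len \<open>j \<noteq> 0\<close> by (intro exI[of _ zs]) (auto simp: C_def cyc_def)
  then have "C \<in> graph_cycles U"
    unfolding graph_cycles_iff[OF ori(3)] using sub by (auto simp: C_def)
  then show ?thesis by auto
qed

text \<open>At a vertex of \<open>C\<close> the arcs of \<open>C\<close> already exhaust the two
  arcs of \<open>U\<close>. Hence no arc of \<open>U\<close> leaves the vertex set of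
  \<open>C\<close>, and connectivity makes that set everything.\<close>

lemma cycle_of_2_regular_graph:
  assumes U: "oriented_graph U" "weakly_connected U"
    and deg: "\<And>v. v \<in> pverts U \<Longrightarrow> card (incident_arcs U v) = 2"
    and C: "C \<in> graph_cycles U"
  shows "C = U"
proof -
  note ori = oriented_graphD[OF U(1)]
  obtain p where sub: "pverts C \<subseteq> pverts U" "parcs C \<subseteq> parcs U" and p: "goes_round p C"
    using C unfolding graph_cycles_iff[OF ori(3)] by blast
  have fin: "finite (parcs C)" using sub(2) ori(2) finite_subset by blast
  have inc: "incident_arcs C v = incident_arcs U v" if "v \<in> pverts C" for v
  proof (rule card_seteq)
    show "finite (incident_arcs U v)" using ori(2) by (simp add: incident_arcs_def)
    show "incident_arcs C v \<subseteq> incident_arcs U v" using sub by (auto simp: incident_arcs_def)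
    have "card (incident_arcs U v) = 2" using deg that sub by blast
    then show "card (incident_arcs U v) \<le> card (incident_arcs C v)"
      using two_incident_arcs_of_cycle[OF C fin that] by simp
  qed
  have arc: "(x, y) \<in> parcs C" if "(x, y) \<in> parcs U" "x \<in> pverts C \<or> y \<in> pverts C" for x y
  proof -
    have "(x, y) \<in> incident_arcs U x" "(x, y) \<in> incident_arcs U y"
      using that by (auto simp: incident_arcs_def)
    then have "(x, y) \<in> incident_arcs C x \<or> (x, y) \<in> incident_arcs C y" using inc that(2) by blast
    then show ?thesis by (auto simp: incident_arcs_def)
  qed
  have "pverts C \<noteq> {}" using p unfolding goes_round_iff by force
  moreover have "\<forall>(x, y)\<in>parcs U. x \<in> pverts C \<longleftrightarrow> y \<in> pverts C"
    using arc goes_round_wf[OF C] by blast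
  ultimately have V: "pverts C = pverts U"
    using U(2) sub(1) unfolding weakly_connected_iff_cut[OF ori(3)] by simp
  moreover have "parcs U \<subseteq> parcs C" using arc unfolding V by (auto dest: ori(4))
  then have "parcs C = parcs U" using sub(2) by blast
  ultimately show ?thesis by simp
qed

section \<open>Connected subgraphs\<close>

text \<open>Removing a leaf lowers both counts by one, so the deficient and the balanced case are
  each preserved and can share one induction. The absence of cycles in the deficient case serves to
  show that such a component is not unicyclic, in step with its zero determinant.\<close>

lemma det_gram_connected:
  assumes G: "oriented_graph G" and nz: "\<And>e. e \<in> parcs G \<Longrightarrow> w e \<noteq> 0"
    and U: "oriented_graph U" "weakly_connected U" "parcs U \<subseteq> parcs G"
  shows "card (parcs U) < card (pverts U) \<Longrightarrow>
      graph_cycles U = {} \<and> det_on (pverts U) (gram w (parcs U)) = 0"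
    and "card (parcs U) = card (pverts U) \<Longrightarrow>
      \<exists>C. graph_cycles U = {C} \<and> det_on (pverts U) (gram w (parcs U)) =
        complex_of_real (2 * cmod (edge_wt_prod w (remove_edges U C)) * cycle_alpha G w C)"
proof -
  have "(card (parcs U) < card (pverts U) \<longrightarrow>
      graph_cycles U = {} \<and> det_on (pverts U) (gram w (parcs U)) = 0) \<and>
    (card (parcs U) = card (pverts U) \<longrightarrow>
      (\<exists>C. graph_cycles U = {C} \<and> det_on (pverts U) (gram w (parcs U)) =
        complex_of_real (2 * cmod (edge_wt_prod w (remove_edges U C)) * cycle_alpha G w C)))"
    using U
  proof (induction "card (pverts U)" arbitrary: U rule: less_induct)
    case (less U)
    note ori = oriented_graphD[OF less.prems(1)]
    have fin_inc: "finite (incident_arcs U v)" for v using ori(2) by (simp add: incident_arcs_def)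
    consider (leaf) v where "v \<in> pverts U" "card (incident_arcs U v) = 1"
      | (isolated) v where "v \<in> pverts U" "card (incident_arcs U v) = 0"
      | (branching) "\<And>v. v \<in> pverts U \<Longrightarrow> 2 \<le> card (incident_arcs U v)"
    proof -
      show thesis
      proof (cases "\<forall>v\<in>pverts U. 2 \<le> card (incident_arcs U v)")
        case True
        then show thesis by (intro that(3)) simp
      next
        case False
        then obtain v where v: "v \<in> pverts U" "\<not> 2 \<le> card (incident_arcs U v)" by blast
        then have "card (incident_arcs U v) = 0 \<or> card (incident_arcs U v) = 1" by linarith
        then show thesis using that(1,2) v(1) by metis
      qed
    qed
    then show ?case
    proof cases
      case leaf
      then obtain e where e: "incident_arcs U v = {e}" by (auto simp: card_1_singleton_iff)
      obtain u where u: "u \<in> pverts U" "v \<in> pverts U" "u \<noteq> v" "e \<in> parcs U" "e = (u, v) \<or> e = (v, u)"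
        using leaf_neighbour[OF less.prems(1) e] .
      define U' where "U' = remove_vertex U v"
      have V': "pverts U' = pverts U - {v}" and E': "parcs U' = parcs U - {e}"
        using e by (simp_all add: U'_def remove_vertex_def)
      have cV: "card (pverts U) = Suc (card (pverts U'))"
        using card_Suc_Diff1[OF ori(1) u(2)] V' by simp
      have cE: "card (parcs U) = Suc (card (parcs U'))"
        using card_Suc_Diff1[OF ori(2) u(4)] E' by simp
      have IH: "(card (parcs U') < card (pverts U') \<longrightarrow>
          graph_cycles U' = {} \<and> det_on (pverts U') (gram w (parcs U')) = 0) \<and>
        (card (parcs U') = card (pverts U') \<longrightarrow>
          (\<exists>C. graph_cycles U' = {C} \<and> det_on (pverts U') (gram w (parcs U')) =
            complex_of_real (2 * cmod (edge_wt_prod w (remove_edges U' C)) * cycle_alpha G w C)))"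
      proof (rule less.hyps)
        show "card (pverts U') < card (pverts U)" using cV by simp
        show "oriented_graph U'" "weakly_connected U'"
          unfolding U'_def using less.prems e
          by (simp_all add: oriented_graph_remove_vertex weakly_connected_remove_leaf)
        show "parcs U' \<subseteq> parcs G" using less.prems(3) E' by auto
      qed
      have cyc: "graph_cycles U' = graph_cycles U" "\<And>C. C \<in> graph_cycles U \<Longrightarrow> e \<notin> parcs C"
        using graph_cycles_remove_leaf[OF less.prems(1) e] by (simp_all add: U'_def)
      have det: "det_on (pverts U) (gram w (parcs U)) =
          complex_of_real (cmod (w e)) * det_on (pverts U') (gram w (parcs U'))"
        unfolding V' E'
      proof (rule det_gram_remove_leaf)
        show "w e \<noteq> 0" using nz u(4) less.prems(3) by blast
        show "fst f \<noteq> v \<and> snd f \<noteq> v" if "f \<in> parcs U - {e}" for f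
        proof -
          have "f \<notin> incident_arcs U v" using that e by simp
          then show ?thesis using that by (simp add: incident_arcs_def)
        qed
      qed (use ori(1,2) u in simp_all)
      \<comment> \<open>The leaf arc is off the cycle, so its weight goes to
        \<open>edge_wt_prod\<close> and \<open>cycle_alpha\<close> is unchanged.\<close>
      have wt: "edge_wt_prod w (remove_edges U C) = w e * edge_wt_prod w (remove_edges U' C)"
        if "C \<in> graph_cycles U" for C
      proof -
        have "parcs U - parcs C = insert e (parcs U' - parcs C)" using u(4) cyc(2)[OF that] E' by auto
        then show ?thesis using ori(2) E' by (simp add: edge_wt_prod_def remove_edges_def)
      qed
      show ?thesis
      proof (intro conjI impI)
        assume "card (parcs U) < card (pverts U)"
        then show "graph_cycles U = {}" "det_on (pverts U) (gram w (parcs U)) = 0"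
          using IH cV cE cyc(1) det by simp_all
      next
        assume "card (parcs U) = card (pverts U)"
        then obtain C where "graph_cycles U' = {C}" "det_on (pverts U') (gram w (parcs U')) =
            complex_of_real (2 * cmod (edge_wt_prod w (remove_edges U' C)) * cycle_alpha G w C)"
          using IH cV cE by auto
        then show "\<exists>C. graph_cycles U = {C} \<and> det_on (pverts U) (gram w (parcs U)) =
            complex_of_real (2 * cmod (edge_wt_prod w (remove_edges U C)) * cycle_alpha G w C)"
          using cyc(1) det wt[of C] by (intro exI[of _ C]) (simp add: norm_mult)
      qed
    next
      case isolated
      then have inc: "incident_arcs U v = {}" using fin_inc by simp
      \<comment> \<open>No arc touches \<open>v\<close>, so its singleton is arc-closed and
        connectivity leaves no other vertex. With one vertex and no arcs the balanced case cannot
        occur.\<close>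
      have "{v} = pverts U"
      proof -
        have "\<forall>(x, y)\<in>parcs U. x \<in> {v} \<longleftrightarrow> y \<in> {v}" using inc by (auto simp: incident_arcs_def)
        then show ?thesis
          using less.prems(2) isolated(1) unfolding weakly_connected_iff_cut[OF ori(3)] by blast
      qed
      then have V: "pverts U = {v}" by simp
      have E: "parcs U = {}"
      proof (rule equals0I)
        fix a assume "a \<in> parcs U"
        then show False using ori(4)[of "fst a" "snd a"] V by (metis prod.collapse singletonD)
      qed
      have "C \<notin> graph_cycles U" for C
      proof
        assume "C \<in> graph_cycles U"
        then obtain p where "pverts C \<subseteq> {v}" "goes_round p C"
          unfolding graph_cycles_iff[OF ori(3)] V by blast
        then obtain xs where "distinct xs" "3 \<le> length xs" "set xs \<subseteq> {v}"
          unfolding goes_round_iff by blast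
        then show False using card_mono[of "{v}" "set xs"] distinct_card[of xs] by simp
      qed
      then have "graph_cycles U = {}" by blast
      then show ?thesis unfolding V E by (simp add: gram_def)
    next
      case branching
      have sum: "(\<Sum>v\<in>pverts U. card (incident_arcs U v)) = 2 * card (parcs U)"
        by (rule sum_card_incident_arcs[OF less.prems(1)])
      have le: "(\<Sum>v\<in>pverts U. 2) \<le> (\<Sum>v\<in>pverts U. card (incident_arcs U v))"
        by (intro sum_mono branching)
      show ?thesis
      proof (intro conjI impI)
        assume "card (parcs U) = card (pverts U)"
        then have eq: "(\<Sum>v\<in>pverts U. 2) = (\<Sum>v\<in>pverts U. card (incident_arcs U v))"
          using sum by simp
        \<comment> \<open>Equal sums with every degree at least 2 leave no room for a larger
          degree.\<close>
        have deg: "card (incident_arcs U v) = 2" if "v \<in> pverts U" for v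
          by (rule sum_mono_inv[OF eq branching that ori(1), symmetric])
        have "pverts U \<noteq> {}"
          using less.prems(2) unfolding weakly_connected_iff_cut[OF ori(3)] by simp
        then have "graph_cycles U \<noteq> {}" by (rule cycle_exists[OF less.prems(1) _ branching])
        then have cyc: "graph_cycles U = {U}"
          using cycle_of_2_regular_graph[OF less.prems(1,2) deg] by blast
        then obtain p where p: "goes_round p U"
          using graph_cycles_iff[OF ori(3), of U] by blast
        have "edge_wt_prod w (remove_edges U U) = 1" by (simp add: edge_wt_prod_def remove_edges_def)
        then show "\<exists>C. graph_cycles U = {C} \<and> det_on (pverts U) (gram w (parcs U)) =
            complex_of_real (2 * cmod (edge_wt_prod w (remove_edges U C)) * cycle_alpha G w C)"
          using cyc det_gram_cycle[OF G p less.prems(3) nz] by (intro exI[of _ U]) simp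
      \<comment> \<open>The deficient case is void here: degrees of at least 2 force at least as
        many arcs as vertices.\<close>
      qed (use sum le in simp_all)
    qed
  qed
  note main = this
  show "card (parcs U) < card (pverts U) \<Longrightarrow>
      graph_cycles U = {} \<and> det_on (pverts U) (gram w (parcs U)) = 0"
    by (rule main[THEN conjunct1, THEN mp])
  show "card (parcs U) = card (pverts U) \<Longrightarrow>
      \<exists>C. graph_cycles U = {C} \<and> det_on (pverts U) (gram w (parcs U)) =
        complex_of_real (2 * cmod (edge_wt_prod w (remove_edges U C)) * cycle_alpha G w C)"
    by (rule main[THEN conjunct2, THEN mp])
qed

section \<open>Weak components\<close>

definition component_of :: "'a pair_pre_digraph \<Rightarrow> 'a \<Rightarrow> 'a set" where
  "component_of H x = {y. (x, y) \<in> (parcs H \<union> (parcs H)\<inverse>)\<^sup>*}"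

definition induced_on :: "'a pair_pre_digraph \<Rightarrow> 'a set \<Rightarrow> 'a pair_pre_digraph" where
  "induced_on H A = \<lparr>pverts = A, parcs = parcs H \<inter> A \<times> A\<rparr>"

lemma component_of_refl: "x \<in> component_of H x"
  by (simp add: component_of_def)

lemma component_of_closed:
  assumes "(a, b) \<in> parcs H"
  shows "a \<in> component_of H x \<longleftrightarrow> b \<in> component_of H x"
proof -
  have "(a, b) \<in> parcs H \<union> (parcs H)\<inverse>" "(b, a) \<in> parcs H \<union> (parcs H)\<inverse>" using assms by auto
  then show ?thesis unfolding component_of_def by (auto intro: rtrancl_into_rtrancl)
qed

text \<open>Induction along a connecting chain never leaves \<open>B\<close>. So a component is the
  smallest arc-closed set around \<open>x\<close>, the form that fits the cut criterion.\<close>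

lemma component_of_subset:
  assumes "x \<in> B" and closed: "\<And>a b. (a, b) \<in> parcs H \<Longrightarrow> a \<in> B \<longleftrightarrow> b \<in> B"
  shows "component_of H x \<subseteq> B"
proof
  fix y assume "y \<in> component_of H x"
  then have "(x, y) \<in> (parcs H \<union> (parcs H)\<inverse>)\<^sup>*" by (simp add: component_of_def)
  then show "y \<in> B"
  proof (induction rule: rtrancl_induct)
    case (step y z)
    then show ?case using closed by blast
  qed (rule assms(1))
qed

lemma component_of_eq:
  assumes "y \<in> component_of H x"
  shows "component_of H y = component_of H x"
proof -
  let ?R = "(parcs H \<union> (parcs H)\<inverse>)\<^sup>*"
  have "sym ?R" by (intro sym_rtrancl sym_Un_converse)
  moreover have "(x, y) \<in> ?R" using assms by (simp add: component_of_def)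
  ultimately have "(x, y) \<in> ?R" "(y, x) \<in> ?R" by (auto dest: symD)
  then show ?thesis unfolding component_of_def by (auto intro: rtrancl_trans)
qed

lemma component_of_subset_pverts:
  assumes "oriented_graph H" "x \<in> pverts H"
  shows "component_of H x \<subseteq> pverts H"
  using assms(2) by (rule component_of_subset) (auto dest: oriented_graphD(4)[OF assms(1)])

lemma components_cover:
  assumes "oriented_graph H"
  shows "\<Union>(component_of H ` pverts H) = pverts H"
  using component_of_subset_pverts[OF assms] component_of_refl[of _ H] by blast

lemma components_disjoint: "pairwise disjnt (component_of H ` S)"
proof (intro pairwise_imageI)
  fix x y assume "component_of H x \<noteq> component_of H y"
  then show "disjnt (component_of H x) (component_of H y)"
    using component_of_eq[of _ H x] component_of_eq[of _ H y] unfolding disjnt_iff by metis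
qed

lemma oriented_graph_induced_on:
  assumes "oriented_graph H" "A \<subseteq> pverts H"
  shows "oriented_graph (induced_on H A)"
  using assms(2) by (intro oriented_graph_mono[OF assms(1)]) (auto simp: induced_on_def)

text \<open>A set that is arc-closed in the induced graph is arc-closed in \<open>H\<close>, because
  no arc of \<open>H\<close> leaves the component. It thus contains the component of each of its
  points, which is the whole one.\<close>

lemma weakly_connected_component:
  assumes "oriented_graph H" "x \<in> pverts H"
  shows "weakly_connected (induced_on H (component_of H x))"
proof -
  let ?A = "component_of H x"
  have "oriented_graph (induced_on H ?A)"
    by (intro oriented_graph_induced_on assms component_of_subset_pverts)
  note wf = oriented_graphD(3)[OF this]
  show ?thesis
    unfolding weakly_connected_iff_cut[OF wf]
  proof (intro conjI allI impI)
    show "pverts (induced_on H ?A) \<noteq> {}" using component_of_refl[of x H] by (auto simp: induced_on_def)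
    fix B assume B: "B \<subseteq> pverts (induced_on H ?A)" "B \<noteq> {}"
      and closed: "\<forall>(a, b)\<in>parcs (induced_on H ?A). a \<in> B \<longleftrightarrow> b \<in> B"
    have BA: "B \<subseteq> ?A" using B(1) by (simp add: induced_on_def)
    obtain z where z: "z \<in> B" using B(2) by auto
    have "component_of H z \<subseteq> B"
      using z
    proof (rule component_of_subset)
      fix a b assume ab: "(a, b) \<in> parcs H"
      show "a \<in> B \<longleftrightarrow> b \<in> B"
      proof (cases "a \<in> ?A")
        case True
        then have "(a, b) \<in> parcs (induced_on H ?A)"
          using ab component_of_closed[OF ab] by (simp add: induced_on_def)
        then show ?thesis using closed by blast
      next
        case False
        then show ?thesis using BA component_of_closed[OF ab] by blast
      qed
    qed
    then show "B = pverts (induced_on H ?A)"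
      using BA z component_of_eq[of z H x] by (auto simp: induced_on_def)
  qed
qed

lemma with_proj_inject: "with_proj U = with_proj U' \<longleftrightarrow> U = U'"
  by (auto simp: with_proj_def)

text \<open>Maximality of a subgraph quantifies over general digraphs \<open>K\<close>.
  Compatibility fixes their tail and head maps to \<open>fst\<close> and \<open>snd\<close>, so they
  can be treated as pair digraphs.\<close>

lemma compatible_with_proj_cases:
  assumes "compatible (with_proj G) K"
  obtains K' where "K = with_proj K'"
proof
  show "K = with_proj \<lparr>pverts = verts K, parcs = arcs K\<rparr>"
    using assms by (cases K) (simp add: with_proj_def compatible_def)
qed

text \<open>The part of \<open>U\<close> inside the component is arc-closed in \<open>U\<close> and
  contains \<open>x\<close>, so by the cut criterion it is all of \<open>U\<close>.\<close>

lemma weakly_connected_subgraph_of_component: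
  assumes "subgraph (with_proj U) (with_proj H)" "weakly_connected U"
    and "x \<in> pverts U" "x \<in> component_of H y"
  shows "pverts U \<subseteq> component_of H y" "parcs U \<subseteq> parcs (induced_on H (component_of H y))"
proof -
  let ?B = "pverts U \<inter> component_of H y"
  have sub: "parcs U \<subseteq> parcs H" and wf: "pair_wf_digraph U"
    using assms(1) by (simp_all add: subgraph_with_proj_iff)
  interpret pair_wf_digraph U by (rule wf)
  have "\<forall>(a, b)\<in>parcs U. a \<in> ?B \<longleftrightarrow> b \<in> ?B"
    using component_of_closed[of _ _ H y] sub in_arcsD1 in_arcsD2 by blast
  moreover have "?B \<noteq> {}" "?B \<subseteq> pverts U" using assms(3,4) by auto
  ultimately have "?B = pverts U"
    using assms(2) unfolding weakly_connected_iff_cut[OF wf] by simp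
  then show V: "pverts U \<subseteq> component_of H y" by blast
  show "parcs U \<subseteq> parcs (induced_on H (component_of H y))"
    using sub V in_arcsD1 in_arcsD2 unfolding induced_on_def by force
qed

text \<open>A connected subgraph that meets a component lies in the graph induced on it, and that
  graph is itself connected; hence these are the maximal ones. The result replaces maximality by an
  indexing over vertex sets, as the block decomposition of the determinant requires.\<close>

lemma weak_components_eq:
  assumes H: "oriented_graph H"
  shows "weak_components H = induced_on H ` component_of H ` pverts H"
proof -
  note wfH = oriented_graphD(3)[OF H]
  have comp_sub: "subgraph (with_proj (induced_on H (component_of H x))) (with_proj H)"
    if "x \<in> pverts H" for x
    using component_of_subset_pverts[OF H that]
      oriented_graphD(3)[OF oriented_graph_induced_on[OF H component_of_subset_pverts[OF H that]]] wfH
    unfolding subgraph_with_proj_iff by (simp add: induced_on_def)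
  show ?thesis
  proof (rule equalityI; rule subsetI)
    fix U assume "U \<in> weak_components H"
    then have U: "subgraph (with_proj U) (with_proj H)" "weakly_connected U"
      and max: "\<And>K. K \<noteq> with_proj U \<Longrightarrow> subgraph (with_proj U) K \<Longrightarrow>
        \<not> (subgraph K (with_proj H) \<and> Digraph_Component.connected K)"
      unfolding weak_components_def pre_digraph.max_subgraph_def by blast+
    have wfU: "pair_wf_digraph U" "pverts U \<subseteq> pverts H"
      using U(1) unfolding subgraph_with_proj_iff by blast+
    obtain x where x: "x \<in> pverts U"
      using U(2) unfolding weakly_connected_iff_cut[OF wfU(1)] by blast
    have xH: "x \<in> pverts H" using x wfU(2) by blast
    let ?K = "induced_on H (component_of H x)"
    have "subgraph (with_proj U) (with_proj ?K)"
      using weakly_connected_subgraph_of_component[OF U x component_of_refl] wfU(1)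
        oriented_graphD(3)[OF oriented_graph_induced_on[OF H component_of_subset_pverts[OF H xH]]]
      unfolding subgraph_with_proj_iff by (simp add: induced_on_def)
    then have "with_proj ?K = with_proj U"
      using max[of "with_proj ?K"] comp_sub[OF xH] weakly_connected_component[OF H xH] by blast
    then have "U = ?K" by (simp add: with_proj_inject)
    then show "U \<in> induced_on H ` component_of H ` pverts H" using xH by blast
  next
    fix U assume "U \<in> induced_on H ` component_of H ` pverts H"
    then obtain x where x: "x \<in> pverts H" and U: "U = induced_on H (component_of H x)" by blast
    have "K = with_proj U" if K: "subgraph (with_proj U) K" "subgraph K (with_proj H)"
      "Digraph_Component.connected K" for K
    proof -
      have "compatible (with_proj H) K" using K(2) by (simp add: subgraph_def)
      then obtain K' where K': "K = with_proj K'" by (rule compatible_with_proj_cases)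
      have UK: "pverts U \<subseteq> pverts K'" "parcs U \<subseteq> parcs K'"
        using K(1) unfolding K' subgraph_with_proj_iff by blast+
      have "x \<in> pverts K'" using UK(1) component_of_refl[of x H] by (auto simp: U induced_on_def)
      from weakly_connected_subgraph_of_component[OF K(2,3)[unfolded K'] this component_of_refl]
      have "pverts K' = pverts U" "parcs K' = parcs U" using UK by (auto simp: U induced_on_def)
      then show ?thesis by (simp add: K')
    qed
    then show "U \<in> weak_components H"
      using comp_sub[OF x] weakly_connected_component[OF H x]
      unfolding weak_components_def pre_digraph.max_subgraph_def U by blast
  qed
qed

text \<open>Every arc touching \<open>i\<close> has both ends in the component, so the arcs left out
  have entry 0 at \<open>i\<close>.\<close>

lemma gram_induced_on_component:
  assumes H: "oriented_graph H" and i: "i \<in> component_of H x"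
  shows "gram w (parcs (induced_on H (component_of H x))) i j = gram w (parcs H) i j"
  unfolding gram_def
proof (rule sum.mono_neutral_left)
  show "\<forall>e\<in>parcs H - parcs (induced_on H (component_of H x)). incidence w i e * cnj (incidence w j e) = 0"
  proof
    fix e assume e: "e \<in> parcs H - parcs (induced_on H (component_of H x))"
    then have "fst e \<in> component_of H x \<longleftrightarrow> snd e \<in> component_of H x"
      using component_of_closed[of "fst e" "snd e" H x] by simp
    then have "i \<noteq> fst e" "i \<noteq> snd e" using e i by (cases e; auto simp: induced_on_def)+
    then show "incidence w i e * cnj (incidence w j e) = 0" by (simp add: incidence_eq_0)
  qed
qed (use oriented_graphD(2)[OF H] in \<open>auto simp: induced_on_def\<close>)

text \<open>The Gram matrix is block diagonal over the components. Arcs and vertices agree in total,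
  so either they agree in every component or some component is deficient.\<close>

lemma det_gram_components:
  assumes G: "oriented_graph G" and nz: "\<And>e. e \<in> parcs G \<Longrightarrow> w e \<noteq> 0"
    and H: "oriented_graph H" "parcs H \<subseteq> parcs G" "card (parcs H) = card (pverts H)"
  shows "det_on (pverts H) (gram w (parcs H)) =
    (if \<forall>U\<in>weak_components H. unicyclic U
     then complex_of_real (\<Prod>U\<in>weak_components H.
       2 * cmod (edge_wt_prod w (remove_edges U (the_cycle U))) * cycle_alpha G w (the_cycle U))
     else 0)"
proof -
  note ori = oriented_graphD[OF H(1)]
  define P where "P = component_of H ` pverts H"
  let ?U = "induced_on H"
  let ?f = "\<lambda>U. 2 * cmod (edge_wt_prod w (remove_edges U (the_cycle U))) * cycle_alpha G w (the_cycle U)"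
  have wc: "weak_components H = ?U ` P" unfolding P_def by (rule weak_components_eq[OF H(1)])
  have inj: "inj_on ?U P" by (intro inj_onI) (simp add: induced_on_def)
  have finP: "finite P" using ori(1) by (simp add: P_def)
  have cover: "\<Union>P = pverts H" unfolding P_def by (rule components_cover[OF H(1)])
  have disj: "pairwise disjnt P" unfolding P_def by (rule components_disjoint)
  have fin: "finite A" if "A \<in> P" for A using that ori(1) cover by (metis Union_upper finite_subset)
  have U: "oriented_graph (?U A)" "weakly_connected (?U A)" "parcs (?U A) \<subseteq> parcs G" "pverts (?U A) = A"
    if "A \<in> P" for A
  proof -
    obtain x where x: "x \<in> pverts H" "A = component_of H x" using \<open>A \<in> P\<close> by (auto simp: P_def)
    show "oriented_graph (?U A)" "weakly_connected (?U A)"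
      unfolding x(2) using x(1) H(1)
      by (simp_all add: oriented_graph_induced_on component_of_subset_pverts weakly_connected_component)
    show "parcs (?U A) \<subseteq> parcs G" "pverts (?U A) = A" using H(2) by (auto simp: induced_on_def)
  qed
  have gramU: "gram w (parcs H) i j = gram w (parcs (?U A)) i j" if A: "A \<in> P" "i \<in> A" for A i j
  proof -
    obtain x where "A = component_of H x" using A(1) by (auto simp: P_def)
    then show ?thesis using gram_induced_on_component[OF H(1), of i x w j] A(2) by simp
  qed
  have cross: "gram w (parcs H) i j = 0" if "A \<in> P" "B \<in> P" "A \<noteq> B" "i \<in> A" "j \<in> B" for A B i j
  proof -
    have "j \<notin> A" using disj that by (auto simp: pairwise_def disjnt_iff)
    then have "gram w (parcs (?U A)) i j = 0"
      by (intro gram_eq_0) (auto simp: induced_on_def)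
    then show ?thesis using gramU[OF that(1,4)] by simp
  qed
  have det: "det_on (pverts H) (gram w (parcs H)) = (\<Prod>A\<in>P. det_on A (gram w (parcs (?U A))))"
  proof -
    have "det_on (\<Union>P) (gram w (parcs H)) = (\<Prod>A\<in>P. det_on A (gram w (parcs H)))"
      by (rule det_on_Union_blocks[OF finP fin disj cross])
    also have "\<dots> = (\<Prod>A\<in>P. det_on A (gram w (parcs (?U A))))"
      by (intro prod.cong refl det_on_cong gramU)
    finally show ?thesis by (simp add: cover)
  qed
  have card_pverts: "card (pverts H) = (\<Sum>A\<in>P. card A)"
    using card_Union_disjoint[OF disj fin] cover by simp
  have card_parcs: "card (parcs H) = (\<Sum>A\<in>P. card (parcs (?U A)))"
  proof -
    have "parcs H = (\<Union>A\<in>P. parcs (?U A))"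
    proof (rule equalityI; rule subsetI)
      fix e assume e: "e \<in> parcs H"
      then have "fst e \<in> pverts H" using ori(4)[of "fst e" "snd e"] by simp
      moreover have "fst e \<in> component_of H (fst e)" "snd e \<in> component_of H (fst e)"
        using component_of_refl[of "fst e" H] component_of_closed[of "fst e" "snd e" H "fst e"] e by auto
      ultimately show "e \<in> (\<Union>A\<in>P. parcs (?U A))"
        using e unfolding P_def induced_on_def by (auto intro!: bexI[of _ "fst e"] simp: mem_Times_iff)
    qed (auto simp: induced_on_def)
    moreover have "parcs (?U A) \<inter> parcs (?U B) = {}" if "A \<in> P" "B \<in> P" "A \<noteq> B" for A B
      using disj that by (auto simp: induced_on_def pairwise_def disjnt_iff)
    ultimately show ?thesis
      using finP U(1)[THEN oriented_graphD(2)] by (simp add: card_UN_disjoint)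
  qed
  show ?thesis
  proof (cases "\<forall>A\<in>P. card A \<le> card (parcs (?U A))")
    case True
    \<comment> \<open>No component is short of arcs and the totals agree, so equality holds in each
      component.\<close>
    then have eq: "card (parcs (?U A)) = card (pverts (?U A))" if "A \<in> P" for A
    proof -
      have "(\<Sum>A\<in>P. card A) = (\<Sum>A\<in>P. card (parcs (?U A)))"
        using card_pverts card_parcs H(3) by simp
      from sum_mono_inv[OF this _ that finP] True show ?thesis using U(4)[OF that] by simp
    qed
    have main: "unicyclic (?U A) \<and> det_on A (gram w (parcs (?U A))) = complex_of_real (?f (?U A))"
      if A: "A \<in> P" for A
    proof -
      obtain C where C: "graph_cycles (?U A) = {C}" and
        d: "det_on (pverts (?U A)) (gram w (parcs (?U A))) =
          complex_of_real (2 * cmod (edge_wt_prod w (remove_edges (?U A) C)) * cycle_alpha G w C)"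
        using det_gram_connected(2)[where w = w, OF G nz U(1-3)[OF A] eq[OF A]] by blast
      have "the_cycle (?U A) = C" "\<exists>!C. C \<in> graph_cycles (?U A)"
        unfolding the_cycle_def C by auto
      then show ?thesis using d U(2,4)[OF A] by (simp add: unicyclic_def)
    qed
    then have "det_on (pverts H) (gram w (parcs H)) = complex_of_real (\<Prod>U\<in>weak_components H. ?f U)"
      unfolding det wc prod.reindex[OF inj] by simp
    moreover have "\<forall>U\<in>weak_components H. unicyclic U" using main unfolding wc by blast
    ultimately show ?thesis by simp
  next
    case False
    \<comment> \<open>A deficient component contributes the factor 0 and has no cycle, so the
      unicyclicity test fails as well and both sides are 0.\<close>
    then obtain A where A: "A \<in> P" "card (parcs (?U A)) < card (pverts (?U A))"
      using U(4) by (metis not_le)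
    then have "graph_cycles (?U A) = {} \<and> det_on (pverts (?U A)) (gram w (parcs (?U A))) = 0"
      using det_gram_connected(1)[where w = w, OF G nz U(1-3)[OF A(1)]] by blast
    then have "\<not> unicyclic (?U A)" "det_on A (gram w (parcs (?U A))) = 0"
      using U(4)[OF A(1)] by (auto simp: unicyclic_def)
    then have "\<not> (\<forall>U\<in>weak_components H. unicyclic U)" "det_on (pverts H) (gram w (parcs H)) = 0"
      unfolding det wc using A(1) finP by (blast, auto intro: prod_zero)
    then show ?thesis by (simp only: if_False)
  qed
qed

section \<open>The determinant of the signless Laplacian\<close>

lemma det_eq_det_on:
  assumes "A \<in> carrier_mat n n"
  shows "Determinant.det A = det_on {0..<n} (\<lambda>i j. A $$ (i, j))"
  using assms unfolding Determinant.det_def det_on_def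
  by (auto intro!: sum.cong)

text \<open>Neighbours of \<open>i\<close> correspond to arcs at \<open>i\<close>, since each pair
  of vertices carries at most one arc, and each such arc adds its modulus to the diagonal.\<close>

lemma diagonal_gram:
  assumes G: "oriented_graph G" and nz: "\<And>e. e \<in> parcs G \<Longrightarrow> w e \<noteq> 0"
  shows "complex_of_real (\<Sum>k\<in>pverts G - {i}. cmod (adj_entry G w i k)) = gram w (parcs G) i i"
proof -
  note ori = oriented_graphD[OF G]
  define nbr where "nbr = {k. (i, k) \<in> parcs G \<or> (k, i) \<in> parcs G}"
  have "nbr \<subseteq> pverts G - {i}" using ori(4) unfolding nbr_def by blast
  then have "(\<Sum>k\<in>pverts G - {i}. cmod (adj_entry G w i k)) = (\<Sum>k\<in>nbr. cmod (adj_entry G w i k))"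
    using ori(1) by (intro sum.mono_neutral_right) (auto simp: nbr_def adj_entry_def)
  also have "\<dots> = (\<Sum>e\<in>incident_arcs G i. cmod (w e))"
  proof (rule sum.reindex_bij_witness[of _ "\<lambda>e. if fst e = i then snd e else fst e"
        "\<lambda>k. if (i, k) \<in> parcs G then (i, k) else (k, i)"])
    fix e assume "e \<in> incident_arcs G i"
    then obtain a b where e: "e = (a, b)" "(a, b) \<in> parcs G" "a = i \<or> b = i"
      by (cases e) (auto simp: incident_arcs_def)
    moreover have "a \<noteq> b" "(b, a) \<notin> parcs G" using ori(4)[OF e(2)] by blast+
    ultimately show "(if (i, if fst e = i then snd e else fst e) \<in> parcs G
        then (i, if fst e = i then snd e else fst e) else (if fst e = i then snd e else fst e, i)) = e"
      by auto
    show "(if fst e = i then snd e else fst e) \<in> nbr" using e by (auto simp: nbr_def)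
  next
    fix k assume k: "k \<in> nbr"
    show "(if fst (if (i, k) \<in> parcs G then (i, k) else (k, i)) = i
        then snd (if (i, k) \<in> parcs G then (i, k) else (k, i))
        else fst (if (i, k) \<in> parcs G then (i, k) else (k, i))) = k"
      by auto
    show "(if (i, k) \<in> parcs G then (i, k) else (k, i)) \<in> incident_arcs G i"
      "cmod (w (if (i, k) \<in> parcs G then (i, k) else (k, i))) = cmod (adj_entry G w i k)"
      using k by (auto simp: nbr_def incident_arcs_def adj_entry_def)
  qed
  finally have "complex_of_real (\<Sum>k\<in>pverts G - {i}. cmod (adj_entry G w i k)) =
      (\<Sum>e\<in>incident_arcs G i. complex_of_real (cmod (w e)))" by simp
  also have "\<dots> = (\<Sum>e\<in>incident_arcs G i. incidence w i e * cnj (incidence w i e))"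
    using nz by (intro sum.cong refl incidence_mult_cnj[symmetric]) (auto simp: incident_arcs_def)
  also have "\<dots> = gram w (parcs G) i i"
    unfolding gram_def using ori(2)
    by (intro sum.mono_neutral_left) (auto simp: incident_arcs_def incidence_def)
  finally show ?thesis .
qed

text \<open>At most one arc joins \<open>i\<close> and \<open>j\<close>, and only its column is
  non-zero in both rows.\<close>

lemma off_diagonal_gram:
  assumes G: "oriented_graph G" and nz: "\<And>e. e \<in> parcs G \<Longrightarrow> w e \<noteq> 0" and "i \<noteq> j"
  shows "adj_entry G w i j = gram w (parcs G) i j"
proof (cases "\<exists>e\<in>parcs G. e = (i, j) \<or> e = (j, i)")
  case True
  then obtain e where e: "e \<in> parcs G" "e = (i, j) \<or> e = (j, i)" by blast
  have "incidence w i f * cnj (incidence w j f) = 0" if "f \<in> parcs G - {e}" for f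
  proof -
    obtain a b where f: "f = (a, b)" by (cases f)
    then have "(b, a) \<noteq> e" using oriented_graphD(4)[OF G, of a b] that e(1) by auto
    then have "\<not> ((i = a \<or> i = b) \<and> (j = a \<or> j = b))" using that f e(2) \<open>i \<noteq> j\<close> by auto
    then show ?thesis using incidence_eq_0[of i f w] incidence_eq_0[of j f w] f by auto
  qed
  then have "(\<Sum>f\<in>parcs G - {e}. incidence w i f * cnj (incidence w j f)) = 0"
    by (intro sum.neutral ballI)
  then have "gram w (parcs G) i j = incidence w i e * cnj (incidence w j e)"
    unfolding gram_def sum.remove[OF oriented_graphD(2)[OF G] e(1)] by simp
  then show ?thesis using adj_entry_incidence[of G e w, OF G e(1) nz[OF e(1)] e(2)] by simp
next
  case False
  then have "gram w (parcs G) i j = 0" using \<open>i \<noteq> j\<close> by (intro gram_eq_0) auto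
  then show ?thesis using False by (auto simp: adj_entry_def)
qed

lemma signless_laplacian_gram:
  assumes G: "oriented_graph G" "pverts G = {0..<n}" and nz: "\<And>e. e \<in> parcs G \<Longrightarrow> w e \<noteq> 0"
    and "i < n" "j < n"
  shows "signless_laplacian n G w $$ (i, j) = gram w (parcs G) i j"
proof (cases "i = j")
  case True
  have "(i, i) \<notin> parcs G" using oriented_graphD(4)[OF G(1)] by blast
  then show ?thesis
    using assms(4) diagonal_gram[OF G(1), of w i] nz True
    by (simp add: signless_laplacian_def degree_mat_def adjacency_mat_def adj_entry_def G(2))
next
  case False
  then show ?thesis
    using assms(4,5) off_diagonal_gram[OF G(1) nz False]
    by (simp add: signless_laplacian_def degree_mat_def adjacency_mat_def)
qed

text \<open>On the excluded ray the modulus and the signed real part cancel. The conditions on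
  \<open>wt(C)\<close> in \<open>unicyclic_subgraphs\<close> therefore discard only zero
  terms.\<close>

lemma cycle_alpha_eq_0:
  "\<not> even_cycle C \<Longrightarrow> cycle_wt G w C \<in> neg_reals \<Longrightarrow> cycle_alpha G w C = 0"
  "even_cycle C \<Longrightarrow> cycle_wt G w C \<in> pos_reals \<Longrightarrow> cycle_alpha G w C = 0"
  by (auto simp: cycle_alpha_def neg_reals_def pos_reals_def)

theorem theorem5p1:
  fixes n m :: nat
    and G :: "nat pair_pre_digraph"
    and w :: "nat \<times> nat \<Rightarrow> complex"
  assumes "n \<ge> 2" and "m \<ge> 1"
    and "oriented_graph G"
    and "pverts G = {0..<n}" and "card (parcs G) = m"
    and "weakly_connected G"
    and "\<And>e. e \<in> parcs G \<Longrightarrow> w e \<noteq> 0 \<and> w e \<notin> neg_reals"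
  shows "Determinant.det (signless_laplacian n G w) =
    complex_of_real (\<Sum>H\<in>unicyclic_subgraphs G w. \<Prod>U\<in>weak_components H.
      2 * cmod (edge_wt_prod w (remove_edges U (the_cycle U))) * cycle_alpha G w (the_cycle U))"
proof -
  have G: "oriented_graph G" and V: "pverts G = {0..<n}" by fact+
  have nz: "w e \<noteq> 0" if "e \<in> parcs G" for e using assms(7)[OF that] by simp
  note ori = oriented_graphD[OF G]
  let ?f = "\<lambda>U. 2 * cmod (edge_wt_prod w (remove_edges U (the_cycle U))) * cycle_alpha G w (the_cycle U)"
  let ?Hs = "{H. spanning (with_proj H) (with_proj G) \<and> card (parcs H) = card (pverts G)}"
  let ?Ts = "{T. T \<subseteq> parcs G \<and> card T = card (pverts G)}"
  let ?h = "\<lambda>T. \<lparr>pverts = pverts G, parcs = T\<rparr>"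
  have sub: "oriented_graph H \<and> pverts H = pverts G \<and> parcs H \<subseteq> parcs G"
    if "spanning (with_proj H) (with_proj G)" for H
  proof -
    have H: "pverts H = pverts G" "parcs H \<subseteq> parcs G"
      using that by (auto simp: spanning_def subgraph_with_proj_iff)
    then have "oriented_graph H"
      by (intro oriented_graph_mono[OF G]) (auto dest: ori(4))
    then show ?thesis using H by simp
  qed
  have span: "spanning (with_proj (?h T)) (with_proj G)" if "T \<subseteq> parcs G" for T
  proof -
    have "oriented_graph (?h T)"
      using that by (intro oriented_graph_mono[OF G]) (auto dest: ori(4))
    then show ?thesis
      using that ori(3) oriented_graphD(3) by (simp add: spanning_def subgraph_with_proj_iff)
  qed
  \<comment> \<open>With the vertex set fixed, a spanning subgraph is its arc set, which turns the
    index sets of Cauchy-Binet into subgraphs.\<close>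
  have Hs: "?Hs = ?h ` ?Ts"
  proof (rule equalityI; rule subsetI)
    fix H assume H: "H \<in> ?Hs"
    then have "H = ?h (parcs H)" "parcs H \<in> ?Ts" using sub[of H] by auto
    then show "H \<in> ?h ` ?Ts" by blast
  qed (use span in auto)
  have "Determinant.det (signless_laplacian n G w) =
      det_on {0..<n} (\<lambda>i j. signless_laplacian n G w $$ (i, j))"
    by (rule det_eq_det_on) (simp add: signless_laplacian_def degree_mat_def adjacency_mat_def)
  also have "\<dots> = det_on (pverts G) (gram w (parcs G))"
    unfolding V using signless_laplacian_gram[OF G V nz] by (intro det_on_cong) auto
  also have "\<dots> = (\<Sum>T\<in>?Ts. det_on (pverts G) (gram w T))"
    unfolding gram_def by (rule Cauchy_Binet_det_on[OF ori(1,2)])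
  also have "\<dots> = (\<Sum>H\<in>?Hs. det_on (pverts H) (gram w (parcs H)))"
    unfolding Hs by (subst sum.reindex) (auto simp: inj_on_def)
  \<comment> \<open>A discarded \<open>H\<close> either has a component that is not unicyclic, or a
    cycle whose weight lies on the excluded ray; in both cases its determinant is 0.\<close>
  also have "\<dots> = (\<Sum>H\<in>unicyclic_subgraphs G w. det_on (pverts H) (gram w (parcs H)))"
  proof (rule sum.mono_neutral_right)
    show "finite ?Hs" unfolding Hs using ori(2) by simp
    show "unicyclic_subgraphs G w \<subseteq> ?Hs" by (auto simp: unicyclic_subgraphs_def)
    show "\<forall>H\<in>?Hs - unicyclic_subgraphs G w. det_on (pverts H) (gram w (parcs H)) = 0"
    proof
      fix H assume H: "H \<in> ?Hs - unicyclic_subgraphs G w"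
      then have H': "oriented_graph H" "pverts H = pverts G" "parcs H \<subseteq> parcs G"
        and "card (parcs H) = card (pverts H)" using sub[of H] by auto
      then have det: "det_on (pverts H) (gram w (parcs H)) = (if \<forall>U\<in>weak_components H. unicyclic U
          then complex_of_real (\<Prod>U\<in>weak_components H. ?f U) else 0)"
        using nz by (intro det_gram_components[OF G]) auto
      show "det_on (pverts H) (gram w (parcs H)) = 0"
      proof (cases "\<forall>U\<in>weak_components H. unicyclic U")
        case True
        then obtain U where U: "U \<in> weak_components H"
          "\<not> even_cycle (the_cycle U) \<and> cycle_wt G w (the_cycle U) \<in> neg_reals \<or>
            even_cycle (the_cycle U) \<and> cycle_wt G w (the_cycle U) \<in> pos_reals"
          using H unfolding unicyclic_subgraphs_def by blast
        then have "?f U = 0" using cycle_alpha_eq_0[of "the_cycle U" G w] by auto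
        moreover have "finite (weak_components H)"
          unfolding weak_components_eq[OF H'(1)] using oriented_graphD(1)[OF H'(1)] by simp
        ultimately have "(\<Prod>U\<in>weak_components H. ?f U) = 0" using U(1) by (intro prod_zero) auto
        then show ?thesis using det by simp
      qed (use det in \<open>simp only: if_False\<close>)
    qed
  qed
  also have "\<dots> = (\<Sum>H\<in>unicyclic_subgraphs G w. complex_of_real (\<Prod>U\<in>weak_components H. ?f U))"
  proof (intro sum.cong refl)
    fix H assume H: "H \<in> unicyclic_subgraphs G w"
    then have "oriented_graph H" "parcs H \<subseteq> parcs G" "card (parcs H) = card (pverts H)"
      and "\<forall>U\<in>weak_components H. unicyclic U"
      using sub[of H] by (auto simp: unicyclic_subgraphs_def)
    then show "det_on (pverts H) (gram w (parcs H)) = complex_of_real (\<Prod>U\<in>weak_components H. ?f U)"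
      using det_gram_components[where w = w, OF G nz] by simp
  qed
  finally show ?thesis by (simp only: of_real_sum)
qed

end
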